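(* Let $R$ be a finite set of red points and $B$ a finite set of blue points in the plane, $R\cap B=\emptyset$, such that $R\cup B$ is in general position (no three points collinear). Let $P$ be a convex polygon whose vertices form a subset of $R$. Assume that every point of $R$ that is not a vertex of $P$ lies outside of $P$, every point of $B$ lies in the interior of $P$, and $\big||R|-|B|\big|\le 1$. Then there exists an alternating Hamiltonian path on $R\cup B$.
   Context: An alternating path on $R\cup B$ is a non-self-intersecting (non-crossing) path whose vertices are points of $R\cup B$, whose edges are straight-line segments, and each of whose edges connects two points of opposite colors (one in $R$, one in $B$). An alternating Hamiltonian path on $R\cup B$ is an alternating path that visits all points of $R\cup B$. *)

theory Defs
  imports "HOL-Analysis.Analysis"
begin

definition general_position :: "(real^2) set \<Rightarrow> bool" where
  "general_position S \<longleftrightarrow>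
     (\<forall>a\<in>S. \<forall>b\<in>S. \<forall>c\<in>S. a \<noteq> b \<and> b \<noteq> c \<and> a \<noteq> c \<longrightarrow> \<not> collinear {a, b, c})"

text \<open>Polygons are the full closed regions; the dimension condition excludes the
  empty set, points and segments.\<close>

definition convex_polygon :: "(real^2) set \<Rightarrow> bool" where
  "convex_polygon P \<longleftrightarrow> polytope P \<and> aff_dim P = 2"

definition polygon_vertices :: "(real^2) set \<Rightarrow> (real^2) set" where
  "polygon_vertices P = {v. v extreme_point_of P}"

text \<open>A path is given by the list of its vertices in order; its edges are the closed
  segments between consecutive list entries.\<close>

definition path_edge :: "(real^2) list \<Rightarrow> nat \<Rightarrow> (real^2) set" where
  "path_edge xs i = closed_segment (xs ! i) (xs ! Suc i)"

text \<open>Consecutive edges share only their common endpoint, and any two other edges are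
  disjoint.\<close>

definition non_self_intersecting :: "(real^2) list \<Rightarrow> bool" where
  "non_self_intersecting xs \<longleftrightarrow>
     distinct xs \<and>
     (\<forall>i. Suc (Suc i) < length xs \<longrightarrow>
        path_edge xs i \<inter> path_edge xs (Suc i) = {xs ! Suc i}) \<and>
     (\<forall>i j. Suc i < j \<and> Suc j < length xs \<longrightarrow>
        path_edge xs i \<inter> path_edge xs j = {})"

definition alternating_path :: "(real^2) set \<Rightarrow> (real^2) set \<Rightarrow> (real^2) list \<Rightarrow> bool" where
  "alternating_path R B xs \<longleftrightarrow>
     xs \<noteq> [] \<and> set xs \<subseteq> R \<union> B \<and> non_self_intersecting xs \<and>
     (\<forall>i. Suc i < length xs \<longrightarrow>
        (xs ! i \<in> R \<and> xs ! Suc i \<in> B) \<or> (xs ! i \<in> B \<and> xs ! Suc i \<in> R))"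

definition alternating_Hamiltonian_path ::
    "(real^2) set \<Rightarrow> (real^2) set \<Rightarrow> (real^2) list \<Rightarrow> bool" where
  "alternating_Hamiltonian_path R B xs \<longleftrightarrow> alternating_path R B xs \<and> set xs = R \<union> B"

end

theory Submission
  imports Defs
begin

text \<open>Let \<open>v\<^sub>0, \<dots>, v\<^sub>m\<^sub>-\<^sub>1\<close> be the vertices of the polygon in counterclockwise order and \<open>d\<^sub>i\<close> the
  signed distance (up to scaling) from the side \<open>v\<^sub>i v\<^sub>i\<^sub>+\<^sub>1\<close>, positive inside. For weights \<open>\<lambda>\<^sub>i > 0\<close> the
  cells \<open>C\<^sub>i = {x. \<lambda>\<^sub>i d\<^sub>i x \<le> \<lambda>\<^sub>j d\<^sub>j x for all j}\<close> are convex and cover the plane; neighbouring cells are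
  separated by a line through their common vertex, and the side line of \<open>C\<^sub>i\<close> separates its
  red points from its blue ones. The weights can be chosen so that, after distributing the points
  on cell boundaries suitably, each \<open>C\<^sub>i\<close> contains exactly one more blue point than red points
  that are not vertices (the last cell absorbs the difference of the colour classes): assign points to sides
  with these counts, minimising the product of \<open>d\<^sub>i\<close> over the blue points divided by the product of
  \<open>\<bar>d\<^sub>i\<bar>\<close> over the red ones; the \<open>\<lambda>\<^sub>i\<close> are the exponentials of the dual variables.

  Inside a cell the two colours are separated by a line, and the greedy path that repeatedly deletes
  its current end and moves on to the next bichromatic hull edge leads from \<open>v\<^sub>i\<close> to \<open>v\<^sub>i\<^sub>+\<^sub>1\<close>. These
  paths are concatenated along the polygon.\<close>

section \<open>Orientation and affine functions\<close>

text \<open>Twice the signed area of the triangle \<open>a b c\<close>, positive if it is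
  counterclockwise. As a function of \<open>c\<close> alone it is affine, which makes it a signed
  distance from the line \<open>a b\<close> up to scaling.\<close>

definition orient :: "real^2 \<Rightarrow> real^2 \<Rightarrow> real^2 \<Rightarrow> real" where
  "orient a b c = (b$1 - a$1) * (c$2 - a$2) - (b$2 - a$2) * (c$1 - a$1)"

definition affine_fun :: "(real^2 \<Rightarrow> real) \<Rightarrow> bool" where
  "affine_fun g \<longleftrightarrow> (\<exists>k k1 k2. \<forall>p. g p = k + k1 * p$1 + k2 * p$2)"

text \<open>General position as nonvanishing determinants: weak sign conditions on orientations
  become strict.\<close>

definition gen_pos :: "(real^2) set \<Rightarrow> bool" where
  "gen_pos S \<longleftrightarrow>
     (\<forall>a\<in>S. \<forall>b\<in>S. \<forall>c\<in>S. a \<noteq> b \<and> b \<noteq> c \<and> a \<noteq> c \<longrightarrow> orient a b c \<noteq> 0)"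

lemma gen_posD: "\<lbrakk>gen_pos S; a \<in> S; b \<in> S; c \<in> S; a \<noteq> b; b \<noteq> c; a \<noteq> c\<rbrakk> \<Longrightarrow> orient a b c \<noteq> 0"
  unfolding gen_pos_def by blast

lemma gen_pos_mono: "gen_pos S \<Longrightarrow> T \<subseteq> S \<Longrightarrow> gen_pos T"
  unfolding gen_pos_def by blast

lemma vec2_eq: "(x::real^2) = y \<longleftrightarrow> x$1 = y$1 \<and> x$2 = y$2"
  by (simp add: vec_eq_iff forall_2)

lemma collinear_orient:
  assumes "orient a b c = 0" shows "collinear {a, b, c}"
proof (cases "a = b")
  case True
  then show ?thesis by simp
next
  case False
  have e: "(b$1 - a$1) * (c$2 - a$2) = (b$2 - a$2) * (c$1 - a$1)"
    using assms unfolding orient_def by simp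
  have "\<exists>t. c = a + t *\<^sub>R (b - a)"
  proof (cases "b$1 = a$1")
    case True
    then have n: "b$2 - a$2 \<noteq> 0" using False by (auto simp: vec2_eq)
    then have "c$1 = a$1" using e True by simp
    then have "c = a + ((c$2 - a$2) / (b$2 - a$2)) *\<^sub>R (b - a)"
      using n True by (simp add: vec2_eq)
    then show ?thesis by blast
  next
    case False
    then have n: "b$1 - a$1 \<noteq> 0" by simp
    then have "c$2 - a$2 = (c$1 - a$1) / (b$1 - a$1) * (b$2 - a$2)"
      using e by (simp add: nonzero_eq_divide_eq mult.commute)
    then have "c = a + ((c$1 - a$1) / (b$1 - a$1)) *\<^sub>R (b - a)"
      using n by (simp add: vec2_eq)
    then show ?thesis by blast
  qed
  then obtain t where t: "c = a + t *\<^sub>R (b - a)" by blast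
  have "collinear {0, b - a, c - a}"
    unfolding collinear_lemma using t by auto
  then have "collinear {b, a, c}" by (subst collinear_3) (simp_all add: NO_MATCH_def)
  then show ?thesis by (simp add: insert_commute)
qed

lemma gen_pos_if_general_position: "general_position S \<Longrightarrow> gen_pos S"
  unfolding general_position_def gen_pos_def using collinear_orient by blast

text \<open>Expansion of the 4 by 4 determinant whose columns are \<open>(g x, 1, x$1, x$2)\<close>
  for the four points; its first row depends linearly on the others. Comparisons of bridges and sign
  arguments inside cells rest on this identity.\<close>

lemma affine_fun_four_points:
  assumes "affine_fun g"
  shows "g a * orient b c d - g b * orient a c d + g c * orient a b d - g d * orient a b c = 0"
proof -
  obtain k k1 k2 where g: "\<And>p. g p = k + k1 * p$1 + k2 * p$2"
    using assms unfolding affine_fun_def by blast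
  show ?thesis unfolding g orient_def by algebra
qed

lemma affine_fun_segment:
  assumes "affine_fun g"
  shows "g ((1 - u) *\<^sub>R p + u *\<^sub>R q) = (1 - u) * g p + u * g q"
proof -
  obtain k k1 k2 where g: "\<And>p. g p = k + k1 * p$1 + k2 * p$2"
    using assms unfolding affine_fun_def by blast
  show ?thesis unfolding g by (simp add: algebra_simps)
qed

lemma affine_fun_orient: "affine_fun (orient a b)"
  unfolding affine_fun_def
  by (rule exI[of _ "(b$2 - a$2) * a$1 - (b$1 - a$1) * a$2"], rule exI[of _ "- (b$2 - a$2)"],
      rule exI[of _ "b$1 - a$1"]) (simp add: orient_def algebra_simps)

lemma affine_fun_const: "affine_fun (\<lambda>x. c)"
  unfolding affine_fun_def by (rule exI[of _ c], rule exI[of _ 0], rule exI[of _ 0]) simp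

lemma affine_fun_mult: "affine_fun g \<Longrightarrow> affine_fun (\<lambda>x. c * g x)"
  unfolding affine_fun_def
proof (elim exE)
  fix k k1 k2 assume "\<forall>p. g p = k + k1 * p$1 + k2 * p$2"
  then have "\<forall>p. c * g p = c * k + (c * k1) * p$1 + (c * k2) * p$2"
    by (simp add: algebra_simps)
  then show "\<exists>k k1 k2. \<forall>p. c * g p = k + k1 * p $ 1 + k2 * p $ 2" by blast
qed

lemma affine_fun_diff: "affine_fun f \<Longrightarrow> affine_fun g \<Longrightarrow> affine_fun (\<lambda>x. f x - g x)"
  unfolding affine_fun_def
proof (elim exE)
  fix k k1 k2 l l1 l2
  assume "\<forall>p. f p = k + k1 * p$1 + k2 * p$2" "\<forall>p. g p = l + l1 * p$1 + l2 * p$2"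
  then have "\<forall>p. f p - g p = (k - l) + (k1 - l1) * p$1 + (k2 - l2) * p$2"
    by (simp add: algebra_simps)
  then show "\<exists>k k1 k2. \<forall>p. f p - g p = k + k1 * p $ 1 + k2 * p $ 2" by blast
qed

lemma orient_rotate: "orient b c a = orient a b c"
  unfolding orient_def by algebra

lemma orient_swap: "orient a c b = - orient a b c"
  unfolding orient_def by algebra

lemma orient_swap': "orient b a c = - orient a b c"
  unfolding orient_def by algebra

lemma orient_same [simp]: "orient a b a = 0" "orient a b b = 0" "orient a a b = 0"
  unfolding orient_def by simp_all

section \<open>Segments in general position and their intersections\<close>

lemma closed_segmentE:
  fixes p q :: "real^2"
  assumes "x \<in> closed_segment p q"
  obtains u where "0 \<le> u" "u \<le> 1" "x = (1 - u) *\<^sub>R p + u *\<^sub>R q"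
  using assms unfolding in_segment by blast

lemma gen_pos_segment:
  assumes "gen_pos S" "x \<in> S" "p \<in> S" "q \<in> S" "x \<in> closed_segment p q"
  shows "x = p \<or> x = q"
proof (rule ccontr)
  assume n: "\<not> (x = p \<or> x = q)"
  then have "p \<noteq> q" using assms(5) by auto
  obtain u where "x = (1 - u) *\<^sub>R p + u *\<^sub>R q" using assms(5) by (rule closed_segmentE)
  then have "orient p q x = 0"
    using affine_fun_segment[OF affine_fun_orient, of p q u p q] by simp
  then show False using gen_posD[OF assms(1,3,4,2)] n \<open>p \<noteq> q\<close> by auto
qed

text \<open>A convex combination of two nonnegative values, not both zero, can fail to be positive
  only if all weight is on an endpoint where \<open>g\<close> vanishes.\<close>

lemma affine_fun_segment_zero:
  assumes "affine_fun g" "x \<in> closed_segment p q" "g p \<ge> 0" "g q \<ge> 0" "g x \<le> 0"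
    and "\<not> (g p = 0 \<and> g q = 0)"
  shows "x = p \<and> g p = 0 \<or> x = q \<and> g q = 0"
proof -
  obtain u where u: "0 \<le> u" "u \<le> 1" "x = (1 - u) *\<^sub>R p + u *\<^sub>R q"
    using assms(2) by (rule closed_segmentE)
  have s: "(1 - u) * g p + u * g q \<le> 0" using assms(5) affine_fun_segment[OF assms(1)] u(3) by simp
  have "0 \<le> (1 - u) * g p" "0 \<le> u * g q" using u assms(3,4) by simp_all
  then have z: "(1 - u) * g p = 0" "u * g q = 0" using s by linarith+
  show ?thesis
  proof (cases "u = 0")
    case True
    then show ?thesis using z u(3) by simp
  next
    case False
    then have "g q = 0" using z by simp
    moreover then have "u = 1" using z assms(6) by simp
    ultimately show ?thesis using u(3) by simp
  qed
qed

definition seg_compat :: "(real^2) \<times> (real^2) \<Rightarrow> (real^2) \<times> (real^2) \<Rightarrow> bool" where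
  "seg_compat e f \<longleftrightarrow> closed_segment (fst e) (snd e) \<inter> closed_segment (fst f) (snd f)
      \<subseteq> {fst e, snd e} \<inter> {fst f, snd f}"

lemma seg_compat_sym: "seg_compat e f \<Longrightarrow> seg_compat f e"
  unfolding seg_compat_def by auto

text \<open>A common point lies on both closed sides of \<open>g = 0\<close>, so \<open>g\<close>
  vanishes there. By \<open>nz\<close> at least one of the two segments does not lie in the zero
  set, hence the point is an endpoint of that segment. It is then a point of \<open>S\<close>, and
  general position makes it an endpoint of the other segment too.\<close>

lemma seg_compat_affine:
  assumes "gen_pos S" and "p \<in> S" "q \<in> S" "p' \<in> S" "q' \<in> S" and "affine_fun g"
    and "g p \<ge> 0" "g q \<ge> 0" "g p' \<le> 0" "g q' \<le> 0"
    and nz: "\<not> (g p = 0 \<and> g q = 0 \<and> g p' = 0 \<and> g q' = 0)"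
  shows "seg_compat (p, q) (p', q')"
  unfolding seg_compat_def
proof
  fix x assume "x \<in> closed_segment (fst (p, q)) (snd (p, q)) \<inter> closed_segment (fst (p', q')) (snd (p', q'))"
  then have x: "x \<in> closed_segment p q" "x \<in> closed_segment p' q'" by simp_all
  have pos: "g x \<ge> 0"
  proof -
    obtain u where u: "0 \<le> u" "u \<le> 1" "x = (1 - u) *\<^sub>R p + u *\<^sub>R q"
      using x(1) by (rule closed_segmentE)
    then show ?thesis using affine_fun_segment[OF assms(6)] assms(7,8) by simp
  qed
  have neg: "g x \<le> 0"
  proof -
    obtain u where u: "0 \<le> u" "u \<le> 1" "x = (1 - u) *\<^sub>R p' + u *\<^sub>R q'"
      using x(2) by (rule closed_segmentE)
    then have "g x = (1 - u) * g p' + u * g q'" using affine_fun_segment[OF assms(6)] by simp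
    then show ?thesis using u assms(9,10) by (simp add: add_nonpos_nonpos mult_nonneg_nonpos)
  qed
  have a': "affine_fun (\<lambda>x. (- 1) * g x)" using affine_fun_mult[OF assms(6)] .
  have "x = p \<or> x = q \<or> x = p' \<or> x = q'"
  proof (cases "g p = 0 \<and> g q = 0")
    case True
    then show ?thesis
      using affine_fun_segment_zero[OF a' x(2)] nz pos assms(9,10) by auto
  next
    case False
    then show ?thesis using affine_fun_segment_zero[OF assms(6) x(1) assms(7,8) neg] by blast
  qed
  then have "x \<in> S" using assms(2-5) by blast
  then have "x = p \<or> x = q" "x = p' \<or> x = q'"
    using gen_pos_segment[OF assms(1)] x assms(2-5) by blast+
  then show "x \<in> {fst (p, q), snd (p, q)} \<inter> {fst (p', q'), snd (p', q')}" by auto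
qed

section \<open>Edge sets of paths\<close>

definition path_edges :: "'a list \<Rightarrow> ('a \<times> 'a) set" where
  "path_edges xs = set (zip xs (tl xs))"

text \<open>Non-crossing is stated for sets of vertex pairs instead of list positions, so that paths
  can be extended, joined and cut without index arithmetic.\<close>

definition noncrossing :: "((real^2) \<times> (real^2)) set \<Rightarrow> bool" where
  "noncrossing E \<longleftrightarrow> (\<forall>e\<in>E. \<forall>f\<in>E. e \<noteq> f \<longrightarrow> seg_compat e f)"

lemma path_edges_simps [simp]:
  "path_edges [] = {}" "path_edges [x] = {}"
  "path_edges (x # y # xs) = insert (x, y) (path_edges (y # xs))"
  unfolding path_edges_def by simp_all

lemma path_edges_Cons: "xs \<noteq> [] \<Longrightarrow> path_edges (x # xs) = insert (x, hd xs) (path_edges xs)"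
  by (cases xs) simp_all

lemma path_edges_subset: "path_edges xs \<subseteq> set xs \<times> set xs"
  by (induction xs rule: induct_list012) auto

lemma path_edges_append:
  "xs \<noteq> [] \<Longrightarrow> ys \<noteq> [] \<Longrightarrow>
     path_edges (xs @ ys) = path_edges xs \<union> path_edges ys \<union> {(last xs, hd ys)}"
  by (induction xs rule: induct_list012) (auto simp: path_edges_Cons)

lemma path_edges_join:
  assumes "xs \<noteq> []" "ys \<noteq> []" "last xs = hd ys"
  shows "path_edges (xs @ tl ys) = path_edges xs \<union> path_edges ys"
  using assms by (cases ys; cases "tl ys = []") (auto simp: path_edges_append path_edges_Cons)

section \<open>Separated colour classes\<close>

text \<open>The bridge is the segment \<open>a b\<close> that crosses the separating line \<open>d = 0\<close> at an extreme position;
  \<open>X (a, b)\<close> is the coordinate of this crossing.\<close>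

lemma bridge_exists:
  fixes A B :: "(real^2) set"
  assumes fin: "finite A" "finite B" and ne: "A \<noteq> {}" "B \<noteq> {}" and dis: "A \<inter> B = {}"
    and gp: "gen_pos (A \<union> B)" and aff: "affine_fun d"
    and neg: "\<forall>a\<in>A. d a < 0" and pos: "\<forall>b\<in>B. d b > 0" and s: "s = 1 \<or> s = - (1::real)"
  shows "\<exists>a\<in>A. \<exists>b\<in>B. \<forall>p\<in>A \<union> B - {a, b}. s * orient a b p > 0"
proof -
  obtain k k1 k2 where d: "\<And>p. d p = k + k1 * p$1 + k2 * p$2"
    using aff unfolding affine_fun_def by blast
  \<comment> \<open>Up to the sign \<open>s\<close> and scaling, \<open>l\<close> is the coordinate
    along the line \<open>d = 0\<close>; \<open>X\<close> below interpolates it linearly to the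
    point where \<open>d\<close> vanishes.\<close>
  define l where "l p = s * (k2 * p$1 - k1 * p$2)" for p :: "real^2"
  define X where "X = (\<lambda>(a, b). (l a * d b - l b * d a) / (d b - d a))"
  define K where "K = k1^2 + k2^2"
  \<comment> \<open>Passing to the coordinates \<open>(d, l)\<close> multiplies every orientation by
    \<open>- s * K\<close>.\<close>
  have det: "(d b - d a) * (l p - l a) - (l b - l a) * (d p - d a) = - s * K * orient a b p" for a b p
    unfolding d l_def orient_def K_def by algebra
  obtain a0 b0 where ab0: "a0 \<in> A" "b0 \<in> B" using ne by blast
  have "K \<noteq> 0"
  proof
    assume "K = 0"
    then have "k1 = 0" "k2 = 0" unfolding K_def by (auto simp: sum_power2_eq_zero_iff)
    then have "d a0 = d b0" unfolding d by simp
    then show False using neg pos ab0 by fastforce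
  qed
  moreover have "K \<ge> 0" unfolding K_def by simp
  ultimately have K: "K > 0" by simp
  have "finite (A \<times> B)" "A \<times> B \<noteq> {}" using fin ne by auto
  then obtain z where z: "z \<in> A \<times> B" "\<forall>y\<in>A \<times> B. - X z \<le> - X y"
    using ex_min_if_finite[of "(\<lambda>z. - X z) ` (A \<times> B)"] by (fastforce simp: not_less)
  obtain a b where "z = (a, b)" by (cases z)
  with z have a: "a \<in> A" and b: "b \<in> B" and m: "\<And>a' b'. a' \<in> A \<Longrightarrow> b' \<in> B \<Longrightarrow> X (a', b') \<le> X (a, b)"
    by auto
  have da: "d a < 0" and db: "d b > 0" using a b neg pos by auto
  have "s * orient a b p > 0" if p: "p \<in> A \<union> B - {a, b}" for p
  proof -
    have "a \<noteq> b" using a b dis by auto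
    then have nz: "orient a b p \<noteq> 0" using gen_posD[OF gp, of a b p] a b p by auto
    \<comment> \<open>The pair \<open>(a, b)\<close> maximises \<open>X\<close>. If \<open>p\<close>
      were on the wrong side of the bridge, exchanging it for the endpoint of its own colour would
      push the crossing further.\<close>
    have "s * orient a b p \<ge> 0"
    proof (rule ccontr)
      assume "\<not> ?thesis"
      then have c: "- s * K * orient a b p > 0"
        using K by (metis (no_types) minus_mult_left mult.assoc mult.left_commute mult_pos_neg neg_0_less_iff_less not_le)
      show False
      proof (cases "p \<in> A")
        case True
        then have dp: "d p < 0" using neg by auto
        have "d b * (- s * K * orient a b p) > 0" by (rule mult_pos_pos[OF db c])
        then have "(l p * d b - l b * d p) * (d b - d a) - (l a * d b - l b * d a) * (d b - d p) > 0"
          unfolding det[symmetric] by (simp add: algebra_simps)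
        then have "X (a, b) < X (p, b)" unfolding X_def using db da dp
          by (simp add: divide_simps mult.commute)
        then show False using m[OF True b] by simp
      next
        case False
        then have pB: "p \<in> B" using p by auto
        then have dp: "d p > 0" using pos by auto
        have "(- d a) * (- s * K * orient a b p) > 0" using da by (intro mult_pos_pos[OF _ c]) simp
        then have "(l a * d p - l p * d a) * (d b - d a) - (l a * d b - l b * d a) * (d p - d a) > 0"
          unfolding det[symmetric] by (simp add: algebra_simps)
        then have "X (a, b) < X (a, p)" unfolding X_def using db da dp
          by (simp add: divide_simps mult.commute)
        then show False using m[OF a pB] by simp
      qed
    qed
    moreover have "s * orient a b p \<noteq> 0" using nz s by auto
    ultimately show ?thesis by linarith
  qed
  then show ?thesis using a b by blast
qed


text \<open>For \<open>b\<close> different from \<open>b'\<close>, after multiplication by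
  \<open>s\<close> all four terms of the four-point identity for \<open>d\<close> are negative,
  although they sum to zero. For a common end \<open>b\<close> the two orientations are opposite. In
  \<open>zigzag\<close> this puts the deleted end on the far side of the next bridge.\<close>

lemma bridge_unique:
  assumes aff: "affine_fun d" and d: "d a < 0" "d a' < 0" "d b > 0" "d b' > 0"
    and s: "s = 1 \<or> s = - (1::real)" and ne: "a \<noteq> a'"
    and br: "b' \<noteq> b \<longrightarrow> s * orient a b b' > 0" "s * orient a b a' > 0"
    and br': "b \<noteq> b' \<longrightarrow> s * orient a' b' b > 0" "s * orient a' b' a > 0"
  shows False
proof (cases "b = b'")
  case True
  have "orient a' b a = - orient a b a'" unfolding orient_def by algebra
  then show ?thesis using True br(2) br'(2) by simp
next
  case False
  have e: "d a * orient b a' b' - d b * orient a a' b' + d a' * orient a b b' - d b' * orient a b a' = 0"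
    using affine_fun_four_points[OF aff] .
  have "s * (d a * orient b a' b' - d b * orient a a' b' + d a' * orient a b b' - d b' * orient a b a') = 0"
    unfolding e by simp
  moreover have "orient b a' b' = orient a' b' b" "orient a a' b' = orient a' b' a"
    unfolding orient_def by algebra+
  ultimately have "d a * (s * orient a' b' b) - d b * (s * orient a' b' a)
      + d a' * (s * orient a b b') - d b' * (s * orient a b a') = 0"
    by (simp add: algebra_simps)
  moreover have "d a * (s * orient a' b' b) < 0" "d b * (s * orient a' b' a) > 0"
    "d a' * (s * orient a b b') < 0" "d b' * (s * orient a b a') > 0"
    using d br br' False by (simp_all add: mult_neg_pos)
  ultimately show ?thesis by linarith
qed

lemma noncrossing_insert:
  assumes "noncrossing E" "\<And>f. f \<in> E \<Longrightarrow> f \<noteq> e \<Longrightarrow> seg_compat e f"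
  shows "noncrossing (insert e E)"
  using assms unfolding noncrossing_def by (auto intro: seg_compat_sym)

lemma noncrossing_mono: "noncrossing E \<Longrightarrow> F \<subseteq> E \<Longrightarrow> noncrossing F"
  unfolding noncrossing_def by blast

text \<open>The sign \<open>s\<close> makes the statement symmetric under exchanging the colours, as needed by the induction.
  The condition on \<open>t\<close> says that \<open>t\<close> cannot be the end of a bridge while other points of its colour
  are left, so \<open>t\<close> is visited last among them.\<close>

lemma zigzag:
  fixes A B :: "(real^2) set"
  assumes "finite A" "finite B" and "A \<inter> B = {}" and "gen_pos (A \<union> B)" and "affine_fun d"
    and "\<forall>p\<in>A. d p < 0" and "\<forall>p\<in>B. d p > 0" and "s = 1 \<or> s = - (1::real)"
    and "a \<in> A" and "card A = card B \<or> card A = Suc (card B)"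
    and "B \<noteq> {} \<longrightarrow> (\<exists>b\<in>B. \<forall>p\<in>A \<union> B - {a, b}. s * orient a b p > 0)"
    and "t \<in> A \<union> B \<longrightarrow> (\<forall>x\<in>A. \<forall>y\<in>B. x \<noteq> t \<and> y \<noteq> t \<longrightarrow> s * orient x y t > 0)"
  shows "\<exists>xs. xs \<noteq> [] \<and> set xs = A \<union> B \<and> distinct xs \<and> hd xs = a
    \<and> successively (\<lambda>x y. x \<in> A \<and> y \<in> B \<or> x \<in> B \<and> y \<in> A) xs
    \<and> noncrossing (path_edges xs)
    \<and> (card A = card B \<longrightarrow> last xs \<in> B) \<and> (card A = Suc (card B) \<longrightarrow> last xs \<in> A)
    \<and> (t \<in> A \<union> B \<longrightarrow> last xs = t \<or> (\<exists>ys z. xs = ys @ [t, z]))"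
  using assms
proof (induction "card A + card B" arbitrary: A B a s d rule: less_induct)
  case less
  note fin = less.prems(1,2) and dis = less.prems(3) and gp = less.prems(4) and aff = less.prems(5)
    and neg = less.prems(6) and pos = less.prems(7) and s = less.prems(8) and a = less.prems(9)
    and crd = less.prems(10) and br = less.prems(11) and t = less.prems(12)
  show ?case
  proof (cases "A = {a}")
    case True
    show ?thesis
    proof (cases "B = {}")
      case True
      then show ?thesis using \<open>A = {a}\<close>
        by (intro exI[of _ "[a]"]) (auto simp: noncrossing_def)
    next
      case False
      then have "card B \<noteq> 0" using fin by simp
      then have "card B = 1" using crd True by simp
      then obtain b where b: "B = {b}" using card_1_singletonE by blast
      show ?thesis using \<open>A = {a}\<close> b dis
        by (intro exI[of _ "[a, b]"]) (auto simp: noncrossing_def)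
    qed
  next
    case False
    define A' where "A' = A - {a}"
    have A'ne: "A' \<noteq> {}" using False a unfolding A'_def by auto
    have cA': "card A = Suc (card A')" unfolding A'_def using card.remove[OF fin(1) a] .
    have finA': "finite A'" using fin unfolding A'_def by simp
    have "card A' \<noteq> 0" using A'ne finA' by simp
    then have "card B \<noteq> 0" using crd cA' by auto
    then have Bne: "B \<noteq> {}" by auto
    have AA': "A' \<subseteq> A" unfolding A'_def by auto
    obtain b where b: "b \<in> B" and bb: "\<And>p. p \<in> A \<union> B \<Longrightarrow> p \<noteq> a \<Longrightarrow> p \<noteq> b \<Longrightarrow> s * orient a b p > 0"
      using br Bne by blast
    have gp': "gen_pos (B \<union> A')" using AA' by (intro gen_pos_mono[OF gp]) auto
    then have gp'': "gen_pos (A' \<union> B)" by (simp add: Un_commute)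
    have dis': "A' \<inter> B = {}" using dis AA' by auto
    have neg': "\<forall>p\<in>A'. d p < 0" using neg AA' by auto
    \<comment> \<open>The path moves from \<open>a\<close> to the end \<open>b'\<close> of the
      bridge of the remaining points, not to \<open>b\<close>. The induction continues at
      \<open>b'\<close> with the colours exchanged, hence with the signs of \<open>d\<close> and
      \<open>s\<close> reversed.\<close>
    from bridge_exists[OF finA' fin(2) A'ne Bne dis' gp'' aff neg' pos s]
    obtain a' b' where a': "a' \<in> A'" and b': "b' \<in> B"
      and bb': "\<And>p. p \<in> A' \<union> B \<Longrightarrow> p \<noteq> a' \<Longrightarrow> p \<noteq> b' \<Longrightarrow> s * orient a' b' p > 0"
      by blast
    have aA': "a \<notin> A'" "a \<noteq> a'" "a \<noteq> b" "a \<noteq> b'" "a' \<in> A" using a' a b b' dis unfolding A'_def by auto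
    have aff': "affine_fun (\<lambda>x. (- 1) * d x)" using affine_fun_mult[OF aff] .
    have "\<exists>xs. xs \<noteq> [] \<and> set xs = B \<union> A' \<and> distinct xs \<and> hd xs = b'
      \<and> successively (\<lambda>x y. x \<in> B \<and> y \<in> A' \<or> x \<in> A' \<and> y \<in> B) xs
      \<and> noncrossing (path_edges xs)
      \<and> (card B = card A' \<longrightarrow> last xs \<in> A') \<and> (card B = Suc (card A') \<longrightarrow> last xs \<in> B)
      \<and> (t \<in> B \<union> A' \<longrightarrow> last xs = t \<or> (\<exists>ys z. xs = ys @ [t, z]))"
    proof (rule less.hyps[where s = "- s" and d = "\<lambda>x. (- 1) * d x"])
      show "card B + card A' < card A + card B" using cA' by simp
      show "finite B" "finite A'" "B \<inter> A' = {}" "gen_pos (B \<union> A')" using fin finA' dis' gp' by auto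
      show "affine_fun (\<lambda>x. (- 1) * d x)" by (rule aff')
      show "\<forall>p\<in>B. (- 1) * d p < 0" "\<forall>p\<in>A'. (- 1) * d p > 0" using neg' pos by auto
      show "- s = 1 \<or> - s = - 1" using s by auto
      show "b' \<in> B" by (rule b')
      show "card B = card A' \<or> card B = Suc (card A')" using crd cA' by auto
      show "A' \<noteq> {} \<longrightarrow> (\<exists>b\<in>A'. \<forall>p\<in>B \<union> A' - {b', b}. - s * orient b' b p > 0)"
      proof (intro impI bexI[of _ a'] ballI a')
        fix p assume "p \<in> B \<union> A' - {b', a'}"
        then have "s * orient a' b' p > 0" by (intro bb') auto
        then show "- s * orient b' a' p > 0" by (simp add: orient_swap'[of b' a'])
      qed
      show "t \<in> B \<union> A' \<longrightarrow> (\<forall>x\<in>B. \<forall>y\<in>A'. x \<noteq> t \<and> y \<noteq> t \<longrightarrow> - s * orient x y t > 0)"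
      proof (intro impI ballI)
        fix x y assume "t \<in> B \<union> A'" "x \<in> B" "y \<in> A'" "x \<noteq> t \<and> y \<noteq> t"
        then have "s * orient y x t > 0" using t AA' by blast
        then show "- s * orient x y t > 0" by (simp add: orient_swap'[of x y])
      qed
    qed
    then obtain xs where xs: "xs \<noteq> []" "set xs = B \<union> A'" "distinct xs" "hd xs = b'"
      "successively (\<lambda>x y. x \<in> B \<and> y \<in> A' \<or> x \<in> A' \<and> y \<in> B) xs"
      "noncrossing (path_edges xs)"
      "card B = card A' \<longrightarrow> last xs \<in> A'" "card B = Suc (card A') \<longrightarrow> last xs \<in> B"
      "t \<in> B \<union> A' \<longrightarrow> last xs = t \<or> (\<exists>ys z. xs = ys @ [t, z])" by blast
    \<comment> \<open>Another point \<open>a'\<close> of the same colour is left, and the condition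
      on \<open>t\<close> for the pair \<open>(a', b)\<close> contradicts the bridge
      \<open>(a, b)\<close>.\<close>
    have ta: "t \<noteq> a"
    proof
      assume ta: "t = a"
      then have "s * orient a' b a > 0" using t a aA' b by auto
      moreover have "s * orient a b a' > 0" using bb[of a'] aA' b dis by auto
      moreover have "orient a' b a = - orient a b a'" unfolding orient_def by algebra
      ultimately show False by simp
    qed
    \<comment> \<open>A line through \<open>b'\<close> separates the new edge from all later ones:
      the old bridge if \<open>b' = b\<close>, and otherwise the new bridge, which has
      \<open>a\<close> strictly on its other side. In the first case the new edge lies on the line,
      and all remaining points except \<open>b'\<close> are strictly off it.\<close>
    have rest: "\<exists>g. affine_fun g \<and> g a \<le> 0 \<and> g b' = 0 \<and> (\<forall>p\<in>A' \<union> B. g p \<ge> 0)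
        \<and> (g a = 0 \<longrightarrow> (\<forall>p\<in>A' \<union> B - {b'}. g p > 0))"
    proof (cases "b' = b")
      case True
      have p: "s * orient a b p > 0" if "p \<in> A' \<union> B - {b'}" for p
        using that True aA'(1) AA' a dis by (intro bb) auto
      then have "s * orient a b p \<ge> 0" if "p \<in> A' \<union> B" for p
        using that True p[of p] by (cases "p = b") (auto intro: less_imp_le)
      then show ?thesis using p True
        by (intro exI[of _ "\<lambda>x. s * orient a b x"]) (simp add: affine_fun_mult affine_fun_orient)
    next
      case False
      have "\<not> s * orient a' b' a > 0"
      proof
        assume h: "s * orient a' b' a > 0"
        show False
        proof (rule bridge_unique[OF aff _ _ _ _ s aA'(2), of b b'])
          show "d a < 0" "d a' < 0" "d b > 0" "d b' > 0" using neg pos a aA'(5) b b' by simp_all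
          show "b' \<noteq> b \<longrightarrow> s * orient a b b' > 0" using b' aA'(4) by (auto intro!: bb)
          show "s * orient a b a' > 0" using aA'(2,5) b dis by (intro bb) auto
          show "b \<noteq> b' \<longrightarrow> s * orient a' b' b > 0" using b a' dis' by (auto intro!: bb')
        qed (rule h)
      qed
      moreover have "orient a' b' a \<noteq> 0"
        using a aA' b' dis by (intro gen_posD[OF gp]) auto
      ultimately have neg_a: "s * orient a' b' a < 0" using s by auto
      have "s * orient a' b' p \<ge> 0" if "p \<in> A' \<union> B" for p
        using that bb'[of p] by (cases "p = a' \<or> p = b'") (auto intro: less_imp_le)
      moreover have "s * orient a' b' a \<noteq> 0" using neg_a by linarith
      ultimately show ?thesis using neg_a
        by (intro exI[of _ "\<lambda>x. s * orient a' b' x"])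
          (simp add: affine_fun_mult affine_fun_orient del: mult_eq_0_iff)
    qed
    then obtain g where g: "affine_fun g" "g a \<le> 0" "g b' = 0" "\<And>p. p \<in> A' \<union> B \<Longrightarrow> g p \<ge> 0"
      "\<And>p. g a = 0 \<Longrightarrow> p \<in> A' \<union> B \<Longrightarrow> p \<noteq> b' \<Longrightarrow> g p > 0" by blast
    have nc: "noncrossing (path_edges (a # xs))"
      unfolding path_edges_Cons[OF xs(1)] xs(4)
    proof (rule noncrossing_insert[OF xs(6)])
      fix f assume f: "f \<in> path_edges xs" 
      obtain p q where pq: "f = (p, q)" by (cases f)
      then have m: "p \<in> A' \<union> B" "q \<in> A' \<union> B" using f path_edges_subset[of xs] xs(2) by auto
      have "p \<noteq> q" 
      proof -
        have "\<And>p q. (p, q) \<in> path_edges xs \<Longrightarrow> p \<noteq> q"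
          using xs(3) by (induction xs rule: induct_list012) auto
        then show ?thesis using f pq by blast
      qed
      then have "\<not> (g p = 0 \<and> g q = 0 \<and> g a = 0 \<and> g b' = 0)" using g(5) m by (metis less_irrefl)
      then have "seg_compat (p, q) (a, b')"
        using m a b' g AA' by (intro seg_compat_affine[OF gp _ _ _ _ g(1)]) auto
      then show "seg_compat (a, b') f" using pq seg_compat_sym by blast
    qed
    have "successively (\<lambda>x y. x \<in> A \<and> y \<in> B \<or> x \<in> B \<and> y \<in> A) xs"
      using AA' by (intro successively_mono[OF xs(5)]) blast
    then have suc: "successively (\<lambda>x y. x \<in> A \<and> y \<in> B \<or> x \<in> B \<and> y \<in> A) (a # xs)"
      using xs(1,4) a b' by (simp add: successively_Cons)
    have tl: "t \<in> A \<union> B \<longrightarrow> last (a # xs) = t \<or> (\<exists>ys z. a # xs = ys @ [t, z])"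
    proof
      assume "t \<in> A \<union> B"
      then have "t \<in> B \<union> A'" using ta unfolding A'_def by blast
      then consider "last xs = t" | ys z where "xs = ys @ [t, z]" using xs(9) by blast
      then show "last (a # xs) = t \<or> (\<exists>ys z. a # xs = ys @ [t, z])"
      proof cases
        case 1
        then show ?thesis using xs(1) by simp
      next
        case 2
        then have "a # xs = (a # ys) @ [t, z]" by simp
        then show ?thesis by blast
      qed
    qed
    have st: "set (a # xs) = A \<union> B" using xs(2) a unfolding A'_def by auto
    have di: "distinct (a # xs)" using xs(2,3) aA'(1) a dis by auto
    have l1: "card A = card B \<longrightarrow> last (a # xs) \<in> B" using xs(1,8) cA' by auto
    have l2: "card A = Suc (card B) \<longrightarrow> last (a # xs) \<in> A" using xs(1,7) cA' AA' by auto
    show ?thesis using suc nc tl st di l1 l2 by (intro exI[of _ "a # xs"]) auto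
  qed
qed

section \<open>Convex polygons\<close>

text \<open>The barycentric coordinates of \<open>x\<close> are the orientations of the three
  subtriangles divided by their sum \<open>orient a b c\<close>.\<close>

lemma orient_convex_combination:
  assumes "orient a b c > 0" "orient a b x \<ge> 0" "orient b c x \<ge> 0" "orient c a x \<ge> 0"
  shows "x \<in> convex hull {a, b, c}"
proof -
  define k where "k = orient a b c"
  have k: "k > 0" unfolding k_def by (rule assms)
  have s: "orient b c x + orient c a x + orient a b x = k"
    unfolding k_def orient_def by algebra
  have "k *\<^sub>R x = orient b c x *\<^sub>R a + orient c a x *\<^sub>R b + orient a b x *\<^sub>R c"
    unfolding vec2_eq k_def orient_def by simp algebra
  then have "x = (1 / k) *\<^sub>R (orient b c x *\<^sub>R a + orient c a x *\<^sub>R b + orient a b x *\<^sub>R c)"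
    using k by (metis divideR_right less_irrefl real_scaleR_def scaleR_one scaleR_scaleR divide_inverse mult_1 right_inverse mult.commute)
  then have "x = (orient b c x / k) *\<^sub>R a + (orient c a x / k) *\<^sub>R b + (orient a b x / k) *\<^sub>R c"
    by (simp add: scaleR_right_distrib)
  moreover have "orient b c x / k + orient c a x / k + orient a b x / k = 1"
    using s k by (simp add: add_divide_distrib[symmetric])
  ultimately show ?thesis unfolding convex_hull_3
    using assms k
    by (intro CollectI exI[of _ "orient b c x / k"] exI[of _ "orient c a x / k"] exI[of _ "orient a b x / k"])
       simp
qed

section \<open>Points in convex position in counterclockwise order\<close>

lemma lex_min_exists:
  fixes V :: "(real^2) set"
  assumes "finite V" "V \<noteq> {}"
  shows "\<exists>z\<in>V. \<forall>x\<in>V. z$1 < x$1 \<or> z$1 = x$1 \<and> z$2 \<le> x$2"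
proof -
  obtain y where y: "y \<in> V" "\<forall>x\<in>V. y$1 \<le> x$1"
    using ex_min_if_finite[of "(\<lambda>x. x$1) ` V"] assms by (fastforce simp: not_less)
  have "finite {x\<in>V. x$1 = y$1}" "{x\<in>V. x$1 = y$1} \<noteq> {}" using assms y by auto
  then obtain z where "z \<in> {x\<in>V. x$1 = y$1}" "\<forall>x\<in>{x\<in>V. x$1 = y$1}. z$2 \<le> x$2"
    using ex_min_if_finite[of "(\<lambda>x. x$2) ` {x\<in>V. x$1 = y$1}"] by (fastforce simp: not_less)
  then show ?thesis using y by (intro bexI[of _ z]) force+
qed

text \<open>A replacement for the angle without trigonometry: the vector is scaled to l1-norm 1, and
  on the right half of the l1 unit circle the second coordinate grows with the angle.\<close>

lemma angle_key_mono:
  fixes a1 a2 b1 b2 :: real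
  assumes "a1 * b2 - a2 * b1 > 0" and "a1 > 0 \<or> a1 = 0 \<and> a2 > 0" and "b1 > 0 \<or> b1 = 0 \<and> b2 > 0"
  shows "a2 / (a1 + \<bar>a2\<bar>) < b2 / (b1 + \<bar>b2\<bar>)"
proof -
  have p: "a1 + \<bar>a2\<bar> > 0" "b1 + \<bar>b2\<bar> > 0" using assms by auto
  have "a2 * (b1 + \<bar>b2\<bar>) < b2 * (a1 + \<bar>a2\<bar>)"
  proof (cases "a2 \<ge> 0"; cases "b2 \<ge> 0")
    assume "a2 \<ge> 0" "\<not> b2 \<ge> 0"
    then have "a1 * b2 \<le> 0" "a2 * b1 \<ge> 0" using assms(2,3) by (auto simp: mult_nonneg_nonpos)
    then show ?thesis using assms(1) by linarith
  next
    assume h: "\<not> a2 \<ge> 0" "b2 \<ge> 0"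
    then have "a2 * b2 \<le> 0" by (simp add: mult_nonpos_nonneg)
    then show ?thesis using assms(1) h by (simp add: algebra_simps)
  qed (use assms(1) in \<open>simp_all add: algebra_simps\<close>)
  then show ?thesis using p by (simp add: divide_simps mult.commute)
qed

text \<open>Seen from the lexicographically least point \<open>z\<close>, all others lie in a
  half-plane, so sorting them by angle is a linear order and settles the triples containing
  \<open>z\<close>. If a triple without \<open>z\<close> turned the wrong way, its middle point
  would lie in the triangle of \<open>z\<close> and the other two, against
  \<open>ext\<close>.\<close>

lemma convex_position_order:
  fixes V :: "(real^2) set"
  assumes fin: "finite V" and ne: "V \<noteq> {}" and gp: "gen_pos V"
    and ext: "\<And>x. x \<in> V \<Longrightarrow> x \<notin> convex hull (V - {x})"
  shows "\<exists>vs. set vs = V \<and> distinct vs \<and>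
     (\<forall>i j k. i < j \<and> j < k \<and> k < length vs \<longrightarrow> orient (vs ! i) (vs ! j) (vs ! k) > 0)"
proof -
  obtain z where z: "z \<in> V" "\<forall>x\<in>V. z$1 < x$1 \<or> z$1 = x$1 \<and> z$2 \<le> x$2"
    using lex_min_exists[OF fin ne] by blast
  define key where "key x = (x$2 - z$2) / ((x$1 - z$1) + \<bar>x$2 - z$2\<bar>)" for x :: "real^2"
  define W where "W = V - {z}"
  have kl: "key x < key y" if "x \<in> W" "y \<in> W" "orient z x y > 0" for x y
    unfolding key_def
  proof (rule angle_key_mono)
    have *: "u$1 - z$1 > 0 \<or> u$1 - z$1 = 0 \<and> u$2 - z$2 > 0" if "u \<in> W" for u
      using that z(2) unfolding W_def by (force simp: vec2_eq)
    show "x$1 - z$1 > 0 \<or> x$1 - z$1 = 0 \<and> x$2 - z$2 > 0" "y$1 - z$1 > 0 \<or> y$1 - z$1 = 0 \<and> y$2 - z$2 > 0"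
      using * that by blast+
    show "(x$1 - z$1) * (y$2 - z$2) - (x$2 - z$2) * (y$1 - z$1) > 0"
      using that(3) unfolding orient_def .
  qed
  obtain ws where ws: "set ws = W" "distinct ws" "sorted (map key ws)"
  proof -
    obtain xs where "set xs = W" "distinct xs" using finite_distinct_list[of W] fin W_def by auto
    then show ?thesis using that[of "sort_key key xs"] by simp
  qed
  have zo: "orient z (ws ! i) (ws ! j) > 0" if "i < j" "j < length ws" for i j
  proof -
    have m: "ws ! i \<in> W" "ws ! j \<in> W" "ws ! i \<noteq> ws ! j"
      using that ws(1,2) nth_mem nth_eq_iff_index_eq by (auto simp: nth_eq_iff_index_eq)
    then have "orient z (ws ! i) (ws ! j) \<noteq> 0" using z(1) unfolding W_def
      by (intro gen_posD[OF gp]) auto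
    moreover have "\<not> orient z (ws ! j) (ws ! i) > 0"
      using kl[OF m(2,1)] sorted_nth_mono[OF ws(3), of i j] that by auto
    ultimately show ?thesis using orient_swap[of z "ws ! j" "ws ! i"] by linarith
  qed
  have wo: "orient (ws ! i) (ws ! j) (ws ! k) > 0" if "i < j" "j < k" "k < length ws" for i j k
  proof (rule ccontr)
    assume n: "\<not> orient (ws ! i) (ws ! j) (ws ! k) > 0"
    have m: "ws ! i \<in> W" "ws ! j \<in> W" "ws ! k \<in> W" "ws ! i \<noteq> ws ! j" "ws ! k \<noteq> ws ! j"
      using that ws(1,2) by (auto simp: nth_eq_iff_index_eq)
    have "ws ! j \<in> convex hull {z, ws ! i, ws ! k}"
    proof (rule orient_convex_combination)
      show "orient z (ws ! i) (ws ! k) > 0" "orient z (ws ! i) (ws ! j) \<ge> 0"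
        using zo[of i k] zo[of i j] that by simp_all
      show "orient (ws ! i) (ws ! k) (ws ! j) \<ge> 0" using n by (simp add: orient_swap[of _ "ws ! k"])
      have "orient (ws ! k) z (ws ! j) = orient z (ws ! j) (ws ! k)" unfolding orient_def by algebra
      then show "orient (ws ! k) z (ws ! j) \<ge> 0" using zo[of j k] that by simp
    qed
    moreover have "{z, ws ! i, ws ! k} \<subseteq> V - {ws ! j}" using m z(1) unfolding W_def by auto
    ultimately have "ws ! j \<in> convex hull (V - {ws ! j})" using hull_mono by blast
    then show False using ext m(2) unfolding W_def by blast
  qed
  have "orient ((z # ws) ! i) ((z # ws) ! j) ((z # ws) ! k) > 0"
    if "i < j" "j < k" "k < length (z # ws)" for i j k
  proof -
    obtain j' k' where jk: "j = Suc j'" "k = Suc k'" using \<open>i < j\<close> \<open>j < k\<close> by (metis less_imp_Suc_add)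
    show ?thesis using zo wo that unfolding jk by (cases i) auto
  qed
  moreover have "set (z # ws) = V" "distinct (z # ws)" using ws z unfolding W_def by auto
  ultimately show ?thesis by blast
qed

lemma orient_cyclic:
  assumes o: "\<forall>i j k. i < j \<and> j < k \<and> k < length vs \<longrightarrow> orient (vs ! i) (vs ! j) (vs ! k) > 0"
    and "3 \<le> length vs" "i < length vs" "j < length vs" "j \<noteq> i" "j \<noteq> Suc i mod length vs"
  shows "orient (vs ! i) (vs ! (Suc i mod length vs)) (vs ! j) > 0"
proof (cases "Suc i = length vs")
  case True
  then have "0 < j" "j < i" using assms by auto
  then have "orient (vs ! 0) (vs ! j) (vs ! i) > 0" using o assms by auto
  then show ?thesis using True orient_rotate[of "vs ! 0" "vs ! j" "vs ! i"] by simp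
next
  case False
  then have m: "Suc i mod length vs = Suc i" using assms by auto
  show ?thesis
  proof (cases "j < i")
    case True
    then have "orient (vs ! j) (vs ! i) (vs ! Suc i) > 0" using o False assms by auto
    then show ?thesis using m orient_rotate[of "vs ! i" "vs ! Suc i" "vs ! j"] by simp
  next
    case False
    then have "Suc i < j" using assms m by auto
    then show ?thesis using o assms m by auto
  qed
qed

text \<open>The diagonals from \<open>vs ! 0\<close> cut the polygon into a fan of triangles. The
  last \<open>i\<close> for which \<open>x\<close> is weakly left of the ray from
  \<open>vs ! 0\<close> through \<open>vs ! i\<close> selects the triangle that contains
  \<open>x\<close>.\<close>

lemma in_convex_hull_if_left_of_edges:
  assumes o: "\<forall>i j k. i < j \<and> j < k \<and> k < length vs \<longrightarrow> orient (vs ! i) (vs ! j) (vs ! k) > 0"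
    and len: "3 \<le> length vs"
    and x: "\<And>i. i < length vs \<Longrightarrow> orient (vs ! i) (vs ! (Suc i mod length vs)) x \<ge> 0"
  shows "x \<in> convex hull set vs"
proof -
  define P where "P i \<longleftrightarrow> 1 \<le> i \<and> i < length vs - 1 \<and> orient (vs ! 0) (vs ! i) x \<ge> 0" for i
  have "vs \<noteq> []" using len by auto
  then have "P 1" using x[of 0] len unfolding P_def by auto
  moreover have "\<forall>y. P y \<longrightarrow> id y < length vs" unfolding P_def by auto
  ultimately obtain i where i: "P i" "\<And>k. P k \<Longrightarrow> k \<le> i" using ex_has_greatest_nat[of P 1 id] by (metis id_apply)
  have il: "Suc i < length vs" "1 \<le> i" using i(1) unfolding P_def by auto
  have e: "orient (vs ! 0) (vs ! Suc i) x \<le> 0"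
  proof (cases "Suc i = length vs - 1")
    case True
    then have "Suc (Suc i) = length vs" using il by simp
    then have "orient (vs ! Suc i) (vs ! 0) x \<ge> 0" using x[of "Suc i"] by simp
    then show ?thesis using orient_swap'[of "vs ! Suc i" "vs ! 0" x] by simp
  next
    case False
    then have "\<not> P (Suc i)" "1 \<le> Suc i" "Suc i < length vs - 1" using i(2)[of "Suc i"] il by auto
    then show ?thesis unfolding P_def by linarith
  qed
  have "x \<in> convex hull {vs ! 0, vs ! i, vs ! Suc i}"
  proof (rule orient_convex_combination)
    show "orient (vs ! 0) (vs ! i) (vs ! Suc i) > 0" using o il by auto
    show "orient (vs ! 0) (vs ! i) x \<ge> 0" using i(1) P_def by auto
    show "orient (vs ! i) (vs ! Suc i) x \<ge> 0" using x[of i] il by simp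
    show "orient (vs ! Suc i) (vs ! 0) x \<ge> 0" using e orient_swap'[of "vs ! Suc i" "vs ! 0" x] by simp
  qed
  moreover have "{vs ! 0, vs ! i, vs ! Suc i} \<subseteq> set vs" using il by (auto intro!: nth_mem)
  ultimately show ?thesis using hull_mono by blast
qed

lemma affine_fun_convex_hull_nonneg:
  assumes "affine_fun g" "\<And>v. v \<in> V \<Longrightarrow> g v \<ge> 0" "x \<in> convex hull V"
  shows "g x \<ge> 0"
proof -
  have "convex {y. g y \<ge> 0}"
    unfolding convex_alt using affine_fun_segment[OF assms(1)] by simp
  then show ?thesis using hull_minimal[of V "{y. g y \<ge> 0}" convex] assms by auto
qed

text \<open>If \<open>g\<close> vanished at \<open>x\<close>, a short step from \<open>x\<close>
  away from \<open>w\<close> would stay in \<open>S\<close> and make \<open>g\<close>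
  negative.\<close>

lemma affine_fun_interior_pos:
  assumes g: "affine_fun g" and nn: "\<And>y. y \<in> S \<Longrightarrow> g y \<ge> 0" and x: "x \<in> interior S" and w: "g w > 0"
  shows "g x > 0"
proof (rule ccontr)
  assume "\<not> g x > 0"
  moreover have "g x \<ge> 0" using nn x interior_subset by blast
  ultimately have gx: "g x = 0" by simp
  obtain e where e: "e > 0" "ball x e \<subseteq> S" using x mem_interior by blast
  define u where "u = - (e / 2) / (norm (w - x) + 1)"
  define y where "y = (1 - u) *\<^sub>R x + u *\<^sub>R w"
  have np: "norm (w - x) + 1 > 0" by (simp add: add_nonneg_pos)
  have u: "u < 0" unfolding u_def using e np by (simp add: divide_neg_pos)
  have "y - x = u *\<^sub>R (w - x)" unfolding y_def by (simp add: algebra_simps)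
  then have "norm (y - x) = \<bar>u\<bar> * norm (w - x)" by simp
  then have "dist x y = \<bar>u\<bar> * norm (w - x)" unfolding dist_norm by (simp only: norm_minus_commute)
  also have "\<dots> = e / 2 * (norm (w - x) / (norm (w - x) + 1))"
    unfolding u_def using e np by (simp add: abs_divide)
  also have "\<dots> \<le> e / 2 * 1" using e np by (intro mult_left_mono) (auto simp: divide_simps)
  also have "\<dots> < e" using e by simp
  finally have "y \<in> S" using e by auto
  then have "g y \<ge> 0" using nn by blast
  moreover have "g y = u * g w" unfolding y_def affine_fun_segment[OF g] gx by simp
  ultimately show False using u w by (simp add: zero_le_mult_iff)
qed

text \<open>By Krein-Milman \<open>P\<close> is the hull of its extreme points, which are finitely
  many and in convex position. The last two conjuncts translate the position of a point relative to
  \<open>P\<close> into signs of the side functions.\<close>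

lemma polygon_sides:
  assumes P: "convex_polygon P" and gp: "gen_pos (polygon_vertices P)"
  shows "\<exists>vs. set vs = polygon_vertices P \<and> distinct vs \<and> 3 \<le> length vs \<and>
    (\<forall>i<length vs. \<forall>j<length vs. j \<noteq> i \<longrightarrow> j \<noteq> Suc i mod length vs \<longrightarrow>
        orient (vs ! i) (vs ! (Suc i mod length vs)) (vs ! j) > 0) \<and>
    (\<forall>x. (\<forall>i<length vs. orient (vs ! i) (vs ! (Suc i mod length vs)) x \<ge> 0) \<longrightarrow> x \<in> P) \<and>
    (\<forall>x\<in>interior P. \<forall>i<length vs. orient (vs ! i) (vs ! (Suc i mod length vs)) x > 0)"
proof -
  define V where "V = polygon_vertices P"
  have poly: "polytope P" and dim: "aff_dim P = 2" using P unfolding convex_polygon_def by auto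
  have hull: "P = convex hull V"
    unfolding V_def polygon_vertices_def
    using Krein_Milman_Minkowski poly polytope_imp_compact polytope_imp_convex by blast
  have fin: "finite V" unfolding V_def polygon_vertices_def
    using finite_polyhedron_extreme_points poly polytope_imp_polyhedron by blast
  have c3: "3 \<le> card V"
    using aff_dim_le_card[OF fin] dim unfolding hull by (simp add: aff_dim_convex_hull)
  have ext: "x \<notin> convex hull (V - {x})" if x: "x \<in> V" for x
  proof -
    have "x extreme_point_of P" using x unfolding V_def polygon_vertices_def by simp
    then have "convex (P - {x})"
      using extreme_point_of_stillconvex[of P x] poly polytope_imp_convex by blast
    then have "convex (convex hull V - {x})" using hull by simp
    then have "convex hull (V - {x}) \<subseteq> convex hull V - {x}"
      by (intro hull_minimal) (auto intro: hull_inc)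
    then show ?thesis by blast
  qed
  have "V \<noteq> {}" using c3 by auto
  from convex_position_order[OF fin this _ ext] gp
  obtain vs where vs: "set vs = V" "distinct vs"
    and o: "\<forall>i j k. i < j \<and> j < k \<and> k < length vs \<longrightarrow> orient (vs ! i) (vs ! j) (vs ! k) > 0"
    unfolding V_def by blast
  have len: "3 \<le> length vs" using c3 vs distinct_card by metis
  have side: "orient (vs ! i) (vs ! (Suc i mod length vs)) (vs ! j) > 0"
    if "i < length vs" "j < length vs" "j \<noteq> i" "j \<noteq> Suc i mod length vs" for i j
    using orient_cyclic[OF o len] that by blast
  have nn: "orient (vs ! i) (vs ! (Suc i mod length vs)) x \<ge> 0" if "i < length vs" "x \<in> P" for i x
  proof (rule affine_fun_convex_hull_nonneg[OF affine_fun_orient])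
    show "x \<in> convex hull V" using that hull by simp
    fix v assume "v \<in> V"
    then obtain j where "j < length vs" "v = vs ! j" using vs by (metis in_set_conv_nth)
    then show "orient (vs ! i) (vs ! (Suc i mod length vs)) v \<ge> 0"
      using side[of i j] that(1) by (cases "j = i \<or> j = Suc i mod length vs") auto
  qed
  have "orient (vs ! i) (vs ! (Suc i mod length vs)) x > 0" if "i < length vs" "x \<in> interior P" for i x
  proof -
    \<comment> \<open>With at least three vertices, the one after next is off the side
      \<open>i\<close>; it witnesses that the side function is somewhere positive.\<close>
    define j where "j = Suc (Suc i) mod length vs"
    have "j < length vs" "j \<noteq> i" "j \<noteq> Suc i mod length vs"
      using len that(1) unfolding j_def by (auto simp: mod_Suc)
    then show ?thesis using affine_fun_interior_pos[OF affine_fun_orient nn[OF that(1)] that(2)]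
        side that(1) by blast
  qed
  moreover have "x \<in> P" if "\<And>i. i < length vs \<Longrightarrow> orient (vs ! i) (vs ! (Suc i mod length vs)) x \<ge> 0" for x
    using in_convex_hull_if_left_of_edges[OF o len that] vs(1) hull by simp
  ultimately show ?thesis using vs len side unfolding V_def by (intro exI[of _ vs]) blast
qed

section \<open>Minimum-cost assignments\<close>

fun walk_cost :: "('i \<Rightarrow> 'i \<Rightarrow> real) \<Rightarrow> 'i list \<Rightarrow> real" where
  "walk_cost w (x # y # xs) = w x y + walk_cost w (y # xs)"
| "walk_cost w _ = 0"

lemma walk_cost_append:
  "xs \<noteq> [] \<Longrightarrow> walk_cost w (xs @ y # ys) = walk_cost w (xs @ [y]) + walk_cost w (y # ys)"
proof (induction xs rule: induct_list012)
  case (3 x z zs)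
  then show ?case by (cases zs) auto
qed auto

lemma walk_cost_snoc: "xs \<noteq> [] \<Longrightarrow> walk_cost w (xs @ [y]) = walk_cost w xs + w (last xs) y"
  by (induction xs rule: induct_list012) auto

lemma walk_cost_nth: "walk_cost w xs = (\<Sum>k<length xs - 1. w (xs ! k) (xs ! Suc k))"
proof (induction xs rule: induct_list012)
  case (3 x y zs)
  then show ?case by (simp del: sum.lessThan_Suc add: sum.lessThan_Suc_shift)
qed auto

text \<open>Shortest-path potentials: \<open>u i\<close> is the least cost of a simple walk in
  \<open>I\<close> that ends in \<open>i\<close>, with free start. If an arc from \<open>i\<close>
  leads back to a vertex \<open>j\<close> of the walk, the closed part is a cycle of nonnegative
  cost and can be cut off.\<close>

lemma potential_exists:
  fixes w :: "'i \<Rightarrow> 'i \<Rightarrow> real"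
  assumes fin: "finite I"
    and cyc: "\<And>xs. xs \<noteq> [] \<Longrightarrow> distinct xs \<Longrightarrow> set xs \<subseteq> I \<Longrightarrow> successively E xs \<Longrightarrow>
          E (last xs) (hd xs) \<Longrightarrow> walk_cost w xs + w (last xs) (hd xs) \<ge> 0"
  shows "\<exists>u. \<forall>i\<in>I. \<forall>j\<in>I. E i j \<longrightarrow> u j \<le> u i + w i j"
proof -
  define Q where "Q i = {xs. xs \<noteq> [] \<and> distinct xs \<and> set xs \<subseteq> I \<and> successively E xs \<and> last xs = i}" for i
  have "finite {xs. set xs \<subseteq> I \<and> distinct xs}"
  proof (rule finite_subset)
    show "{xs. set xs \<subseteq> I \<and> distinct xs} \<subseteq> {xs. set xs \<subseteq> I \<and> length xs \<le> card I}"
      using fin by (auto simp: distinct_card[symmetric] intro: card_mono)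
    show "finite {xs. set xs \<subseteq> I \<and> length xs \<le> card I}" by (rule finite_lists_length_le[OF fin])
  qed
  then have finQ: "finite (Q i)" for i
    by (rule rev_finite_subset) (auto simp: Q_def)
  define u where "u i = Min (walk_cost w ` Q i)" for i
  have ne: "Q i \<noteq> {}" if "i \<in> I" for i
    using that unfolding Q_def by (auto intro!: exI[of _ "[i]"])
  have le: "u i \<le> walk_cost w xs" if "xs \<in> Q i" for i xs
    unfolding u_def using finQ that by auto
  have "u j \<le> u i + w i j" if i: "i \<in> I" and j: "j \<in> I" and e: "E i j" for i j
  proof -
    have "u i \<in> walk_cost w ` Q i" unfolding u_def using finQ ne[OF i] by (intro Min_in) auto
    then obtain xs where xs: "xs \<in> Q i" and c: "u i = walk_cost w xs" by blast
    from xs have x: "xs \<noteq> []" "distinct xs" "set xs \<subseteq> I" "successively E xs" "last xs = i"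
      unfolding Q_def by auto
    show ?thesis
    proof (cases "j \<in> set xs")
      case False
      then have "xs @ [j] \<in> Q j" using x j e unfolding Q_def by (auto simp: successively_append_iff)
      then show ?thesis using le[of "xs @ [j]" j] c x walk_cost_snoc[OF x(1)] by simp
    next
      case True
      then obtain ys zs where s: "xs = ys @ j # zs" using split_list by metis
      have "walk_cost w (j # zs) + w (last (j # zs)) (hd (j # zs)) \<ge> 0"
        using x e unfolding s by (intro cyc) (auto simp: successively_append_iff)
      then have z: "walk_cost w (j # zs) + w i j \<ge> 0" using x(5) s by simp
      have q: "ys @ [j] \<in> Q j" using x s unfolding Q_def
        by (auto simp: successively_append_iff successively_Cons)
      have "walk_cost w xs = walk_cost w (ys @ [j]) + walk_cost w (j # zs)"
        unfolding s by (cases "ys = []") (auto simp: walk_cost_append[of ys w j zs])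
      then show ?thesis using le[OF q] c z by simp
    qed
  qed
  then show ?thesis by blast
qed

text \<open>A point \<open>p\<close> with \<open>s p = 1\<close> adds one unit to its index, one with \<open>s p = - 1\<close> removes one. The
  dual variables \<open>u\<close> exist because a minimal assignment has no negative cycle in its residual graph.\<close>

lemma optimal_assignment:
  fixes s :: "'p \<Rightarrow> real" and c :: "'i \<Rightarrow> 'p \<Rightarrow> real"
  assumes finI: "finite I" and finX: "finite X" and s: "\<And>p. p \<in> X \<Longrightarrow> s p = 1 \<or> s p = - 1"
    and a0: "\<And>p. p \<in> X \<Longrightarrow> a0 p \<in> I \<and> ok (a0 p) p"
  shows "\<exists>a u. (\<forall>p\<in>X. a p \<in> I \<and> ok (a p) p)
     \<and> (\<forall>i\<in>I. (\<Sum>p | p \<in> X \<and> a p = i. s p) = (\<Sum>p | p \<in> X \<and> a0 p = i. s p))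
     \<and> (\<forall>p\<in>X. \<forall>j\<in>I. ok j p \<longrightarrow> c (a p) p + s p * u (a p) \<le> c j p + s p * u j)"
proof -
  define bal where "bal a i = (\<Sum>p | p \<in> X \<and> a p = i. s p)" for a :: "'p \<Rightarrow> 'i" and i
  define cost where "cost a = (\<Sum>p\<in>X. c (a p) p)" for a :: "'p \<Rightarrow> 'i"
  \<comment> \<open>Extensional functions leave only finitely many candidates, so a cheapest one
    exists.\<close>
  define F where "F = {a \<in> X \<rightarrow>\<^sub>E I. (\<forall>p\<in>X. ok (a p) p) \<and> (\<forall>i\<in>I. bal a i = bal a0 i)}"
  have bal_cong: "bal a = bal b" if "\<And>p. p \<in> X \<Longrightarrow> a p = b p" for a b :: "'p \<Rightarrow> 'i"
    unfolding bal_def using that by (intro ext sum.cong) auto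
  have cost_cong: "cost a = cost b" if "\<And>p. p \<in> X \<Longrightarrow> a p = b p" for a b :: "'p \<Rightarrow> 'i"
    unfolding cost_def using that by (intro sum.cong) auto
  have "finite F" unfolding F_def
    using finite_PiE[OF finX, of "\<lambda>_. I"] finI by auto
  moreover have "restrict a0 X \<in> F" unfolding F_def
    using a0 bal_cong[of "restrict a0 X" a0] by auto
  ultimately obtain a where a: "a \<in> F" and amin: "\<And>b. b \<in> F \<Longrightarrow> cost a \<le> cost b"
    using ex_min_if_finite[of "cost ` F"] by (fastforce simp: not_less)
  have amin': "cost a \<le> cost b" if "\<And>p. p \<in> X \<Longrightarrow> b p \<in> I \<and> ok (b p) p" "\<And>i. i \<in> I \<Longrightarrow> bal b i = bal a i" for b
  proof -
    have "restrict b X \<in> F" using that a bal_cong[of "restrict b X" b] unfolding F_def by auto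
    then show ?thesis using amin cost_cong[of "restrict b X" b] by fastforce
  qed
  have aI: "\<And>p. p \<in> X \<Longrightarrow> a p \<in> I" "\<And>p. p \<in> X \<Longrightarrow> ok (a p) p" and ab: "\<And>i. i \<in> I \<Longrightarrow> bal a i = bal a0 i"
    using a unfolding F_def by auto
  \<comment> \<open>Arcs of the residual graph: reassigning \<open>p\<close> transfers one unit of
    balance from \<open>i\<close> to \<open>j\<close>. A positive point moves from \<open>i\<close>
    to \<open>j\<close>, a negative one from \<open>j\<close> to \<open>i\<close>.\<close>
  define mv where "mv i j p \<longleftrightarrow> p \<in> X \<and> (s p = 1 \<and> a p = i \<and> ok j p \<or> s p = - 1 \<and> a p = j \<and> ok i p)" for i j p
  define tgt where "tgt i j p = (if s p = 1 then j else i)" for i j :: 'i and p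
  define dc where "dc i j p = c (tgt i j p) p - c (a p) p" for i j p
  define w where "w i j = Min (dc i j ` {p. mv i j p})" for i j
  define E where "E i j \<longleftrightarrow> (\<exists>p. mv i j p)" for i j
  have finmv: "finite {p. mv i j p}" for i j
    by (rule finite_subset[OF _ finX]) (auto simp: mv_def)
  have wle: "w i j \<le> dc i j p" if "mv i j p" for i j p
    unfolding w_def using finmv that by auto
  have wit: "\<exists>p. mv i j p \<and> w i j = dc i j p" if "E i j" for i j
  proof -
    have "w i j \<in> dc i j ` {p. mv i j p}" unfolding w_def using finmv that
      by (intro Min_in) (auto simp: E_def)
    then show ?thesis by blast
  qed
  have "\<exists>u. \<forall>i\<in>I. \<forall>j\<in>I. E i j \<longrightarrow> u j \<le> u i + w i j"
  proof (rule potential_exists[OF finI])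
    fix xs assume x: "xs \<noteq> []" "distinct xs" "set xs \<subseteq> I" "successively E xs" "E (last xs) (hd xs)"
    define n where "n = length xs"
    define nx where "nx k = (if Suc k = n then 0 else Suc k)" for k
    have n0: "n > 0" using x n_def by simp
    have nxb: "bij_betw nx {..<n} {..<n}"
    proof (rule bij_betwI')
      fix k l show "(nx k = nx l) = (k = l)" if "k \<in> {..<n}" "l \<in> {..<n}" using that by (auto simp: nx_def)
      show "nx k \<in> {..<n}" if "k \<in> {..<n}" using that by (auto simp: nx_def)
      show "\<exists>l\<in>{..<n}. k = nx l" if "k \<in> {..<n}"
        using that n0 by (cases k) (auto simp: nx_def intro: bexI[of _ "n - 1"] bexI[of _ "k - 1"])
    qed
    have nxlt: "nx k < n" if "k < n" for k using that nxb bij_betwE by blast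
    have En: "E (xs ! k) (xs ! nx k)" if "k < n" for k
    proof (cases "Suc k = n")
      case True
      then have "k = length xs - 1" "nx k = 0" unfolding n_def nx_def by auto
      then have "xs ! k = last xs" "xs ! nx k = hd xs" using x(1)
        by (simp_all add: last_conv_nth hd_conv_nth)
      then show ?thesis using x by simp
    next
      case False
      then show ?thesis using x(4) that unfolding nx_def n_def by (simp add: successively_conv_nth)
    qed
    have "\<forall>k. \<exists>p. k < n \<longrightarrow> mv (xs ! k) (xs ! nx k) p \<and> w (xs ! k) (xs ! nx k) = dc (xs ! k) (xs ! nx k) p"
      using wit En by blast
    then obtain q where q: "\<And>k. k < n \<Longrightarrow> mv (xs ! k) (xs ! nx k) (q k)"
      and wq: "\<And>k. k < n \<Longrightarrow> w (xs ! k) (xs ! nx k) = dc (xs ! k) (xs ! nx k) (q k)"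
      by metis
    have qX: "q k \<in> X" if "k < n" for k using q[OF that] mv_def by auto
    have nth_inj: "k = l" if "xs ! k = xs ! l" "k < n" "l < n" for k l
      using that x(2) nth_eq_iff_index_eq n_def by blast
    \<comment> \<open>The sign and the current index of a point fix the tail or the head of each of
      its arcs, and two arcs of a simple cycle with a common tail or a common head coincide.\<close>
    have qinj: "inj_on q {..<n}"
    proof (rule inj_onI)
      fix k l assume kl: "k \<in> {..<n}" "l \<in> {..<n}" "q k = q l"
      then have m: "mv (xs ! k) (xs ! nx k) (q k)" "mv (xs ! l) (xs ! nx l) (q k)"
        using q[of k] q[of l] by auto
      then have "xs ! k = xs ! l \<or> xs ! nx k = xs ! nx l" unfolding mv_def by auto
      then have "k = l \<or> nx k = nx l" using nth_inj nxlt kl by auto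
      then show "k = l" using nxb kl unfolding bij_betw_def inj_on_def by blast
    qed
    define r where "r = the_inv_into {..<n} q"
    have rq: "r (q k) = k" if "k < n" for k
      unfolding r_def using the_inv_into_f_f[OF qinj] that by simp
    \<comment> \<open>All arcs of the cycle are carried out at once. Every index on it gains one
      unit and loses one, so balances are kept and minimality of \<open>a\<close> makes the cost of
      the cycle nonnegative.\<close>
    define b where "b p = (if p \<in> q ` {..<n} then tgt (xs ! r p) (xs ! nx (r p)) p else a p)" for p
    have bq: "b (q k) = tgt (xs ! k) (xs ! nx k) (q k)" if "k < n" for k
      using that rq unfolding b_def by simp
    have sub: "q ` {..<n} \<subseteq> X" using qX by auto
    have diff: "(\<Sum>p\<in>X. h (b p) p) - (\<Sum>p\<in>X. h (a p) p) = (\<Sum>k<n. h (b (q k)) (q k) - h (a (q k)) (q k))"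
      for h :: "'i \<Rightarrow> 'p \<Rightarrow> real"
    proof -
      have "(\<Sum>p\<in>X. h (b p) p) - (\<Sum>p\<in>X. h (a p) p) = (\<Sum>p\<in>X. h (b p) p - h (a p) p)"
        by (simp add: sum_subtractf)
      also have "\<dots> = (\<Sum>p\<in>q ` {..<n}. h (b p) p - h (a p) p)"
        by (rule sum.mono_neutral_right[OF finX sub]) (auto simp: b_def)
      also have "\<dots> = (\<Sum>k<n. h (b (q k)) (q k) - h (a (q k)) (q k))"
        by (simp add: sum.reindex[OF qinj])
      finally show ?thesis .
    qed
    have "cost a \<le> cost b"
    proof (rule amin')
      fix p assume p: "p \<in> X"
      show "b p \<in> I \<and> ok (b p) p"
      proof (cases "p \<in> q ` {..<n}")
        case True
        then obtain k where k: "k < n" "p = q k" by auto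
        have "xs ! k \<in> I" "xs ! nx k \<in> I" using k nxlt x(3) n_def nth_mem by blast+
        then show ?thesis using q[OF k(1)] s[OF p] k bq[OF k(1)] unfolding tgt_def mv_def by auto
      next
        case False
        then show ?thesis using aI p b_def by auto
      qed
    next
      fix i assume i: "i \<in> I"
      define h where "h j p = (if j = i then s p else 0)" for j p
      have bs: "bal f i = (\<Sum>p\<in>X. h (f p) p)" for f
        unfolding bal_def h_def using finX by (simp add: sum.inter_filter)
      have "bal b i - bal a i = (\<Sum>k<n. h (b (q k)) (q k) - h (a (q k)) (q k))"
        unfolding bs by (rule diff)
      also have "\<dots> = (\<Sum>k<n. (if xs ! nx k = i then 1 else 0) - (if xs ! k = i then 1 else 0))"
      proof (rule sum.cong)
        fix k assume "k \<in> {..<n}"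
        then have k: "k < n" by simp
        show "h (b (q k)) (q k) - h (a (q k)) (q k)
            = (if xs ! nx k = i then 1 else 0) - (if xs ! k = i then 1 else 0)"
          using q[OF k] bq[OF k] by (auto simp: h_def tgt_def mv_def)
      qed simp
      also have "\<dots> = (\<Sum>k<n. (if xs ! nx k = i then 1 else 0)) - (\<Sum>k<n. (if xs ! k = i then 1 else 0))"
        by (simp add: sum_subtractf)
      also have "(\<Sum>k<n. (if xs ! nx k = i then 1 else (0::real))) = (\<Sum>k<n. (if xs ! k = i then 1 else 0))"
        by (rule sum.reindex_bij_betw[OF nxb, of "\<lambda>k. if xs ! k = i then 1 else 0"])
      finally show "bal b i = bal a i" by simp
    qed
    then have "0 \<le> (\<Sum>k<n. c (b (q k)) (q k) - c (a (q k)) (q k))"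
      using diff[of c] unfolding cost_def by simp
    also have "\<dots> = (\<Sum>k<n. w (xs ! k) (xs ! nx k))"
      using wq bq by (intro sum.cong) (auto simp: dc_def)
    also have "\<dots> = walk_cost w xs + w (last xs) (hd xs)"
    proof -
      obtain m where m: "n = Suc m" using n0 by (cases n) auto
      have "(\<Sum>k<n. w (xs ! k) (xs ! nx k)) = (\<Sum>k<m. w (xs ! k) (xs ! nx k)) + w (xs ! m) (xs ! 0)"
        unfolding m by (simp add: nx_def m)
      also have "(\<Sum>k<m. w (xs ! k) (xs ! nx k)) = walk_cost w xs"
        unfolding walk_cost_nth using m n_def by (intro sum.cong) (auto simp: nx_def)
      finally show ?thesis using x m n_def by (simp add: last_conv_nth hd_conv_nth)
    qed
    finally show "0 \<le> walk_cost w xs + w (last xs) (hd xs)" .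
  qed
  then obtain u where u: "\<And>i j. i \<in> I \<Longrightarrow> j \<in> I \<Longrightarrow> E i j \<Longrightarrow> u j \<le> u i + w i j" by blast
  \<comment> \<open>The dual variables are the negated potentials. For a negative point the arc runs
    from \<open>j\<close> to its current index, which reverses the roles in the potential
    inequality.\<close>
  have opt: "c (a p) p + s p * (- u (a p)) \<le> c j p + s p * (- u j)"
    if p: "p \<in> X" and j: "j \<in> I" and okj: "ok j p" for p j
  proof (cases "s p = 1")
    case True
    then have "mv (a p) j p" using p okj unfolding mv_def by simp
    then have "u j \<le> u (a p) + dc (a p) j p" using u[OF aI(1)[OF p] j] wle unfolding E_def by fastforce
    then show ?thesis using True unfolding dc_def tgt_def by simp
  next
    case False
    then have sp: "s p = - 1" using s p by auto
    then have "mv j (a p) p" using p okj unfolding mv_def by simp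
    then have "u (a p) \<le> u j + dc j (a p) p" using u[OF j aI(1)[OF p]] wle unfolding E_def by fastforce
    then show ?thesis using sp unfolding dc_def tgt_def by simp
  qed
  show ?thesis
    using aI ab opt unfolding bal_def by (intro exI[of _ a] exI[of _ "\<lambda>i. - u i"]) auto
qed

section \<open>Distribution of the points over the cells\<close>

lemma assignment_with_counts:
  fixes n :: "nat \<Rightarrow> nat"
  assumes "finite B" "card B = (\<Sum>i<m. n i)"
  shows "\<exists>f. (\<forall>b\<in>B. f b < m) \<and> (\<forall>i<m. card {b\<in>B. f b = i} = n i)"
  using assms
proof (induction m arbitrary: B)
  case 0
  then show ?case by auto
next
  case (Suc m)
  then have "n m \<le> card B" by simp
  then obtain C where C: "C \<subseteq> B" "card C = n m" "finite C" using obtain_subset_with_card_n by blast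
  have "card (B - C) = (\<Sum>i<m. n i)" using C Suc.prems by (simp add: card_Diff_subset)
  then obtain f where f: "\<forall>b\<in>B - C. f b < m" "\<forall>i<m. card {b\<in>B - C. f b = i} = n i"
    using Suc.IH[of "B - C"] Suc.prems by auto
  define g where "g b = (if b \<in> C then m else f b)" for b
  have "card {b\<in>B. g b = i} = n i" if "i < Suc m" for i
  proof (cases "i = m")
    case True
    have "{b\<in>B. g b = i} = C" using True C(1) f(1) by (auto simp: g_def)
    then show ?thesis using C True by simp
  next
    case False
    have "{b\<in>B. g b = i} = {b\<in>B - C. f b = i}" using False unfolding g_def by auto
    then show ?thesis using f(2) that False by simp
  qed
  moreover have "\<forall>b\<in>B. g b < Suc m" using f(1) unfolding g_def by (auto simp: less_Suc_eq)
  ultimately show ?case by blast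
qed

text \<open>With logarithmic costs, optimality exponentiates to the cell inequalities for
  \<open>l i = exp (u i)\<close>. Points of \<open>Q\<close> may only use indices where
  \<open>D\<close> is negative, so both logarithms have positive arguments; at an index with
  \<open>D j p\<close> nonnegative the inequality holds by signs.\<close>

lemma balanced_cells:
  fixes D :: "nat \<Rightarrow> 'p \<Rightarrow> real" and n :: "nat \<Rightarrow> nat"
  assumes fin: "finite Q" "finite B" and dis: "Q \<inter> B = {}"
    and B: "\<And>b i. b \<in> B \<Longrightarrow> i < m \<Longrightarrow> D i b > 0"
    and Q: "\<And>r. r \<in> Q \<Longrightarrow> \<exists>i<m. D i r < 0"
    and crd: "card B = card Q + (\<Sum>i<m. n i)"
  shows "\<exists>a l. (\<forall>i. l i > 0) \<and>
      (\<forall>p\<in>Q \<union> B. a p < m \<and> (\<forall>j<m. l (a p) * D (a p) p \<le> l j * D j p)) \<and>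
      (\<forall>r\<in>Q. D (a r) r < 0) \<and>
      (\<forall>i<m. card {b\<in>B. a b = i} = card {r\<in>Q. a r = i} + n i)"
proof -
  define X where "X = Q \<union> B"
  define s where "s p = (if p \<in> B then 1 else - 1 :: real)" for p
  define c where "c i p = (if p \<in> B then ln (D i p) else - ln (- D i p))" for i p
  define ok where "ok i p \<longleftrightarrow> p \<in> B \<or> D i p < 0" for i p
  obtain r where r: "\<And>p. p \<in> Q \<Longrightarrow> r p < m \<and> D (r p) p < 0" using Q by metis
  have "Q = (\<Union>i\<in>{..<m}. {p\<in>Q. r p = i})" using r by auto
  then have "card Q = card (\<Union>i\<in>{..<m}. {p\<in>Q. r p = i})" by (rule arg_cong)
  also have "\<dots> = (\<Sum>i<m. card {p\<in>Q. r p = i})"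
    using fin(1) by (intro card_UN_disjoint) auto
  finally have "card Q = (\<Sum>i<m. card {p\<in>Q. r p = i})" .
  then have "card B = (\<Sum>i<m. card {p\<in>Q. r p = i} + n i)" using crd by (simp add: sum.distrib)
  from assignment_with_counts[OF fin(2) this] obtain f where
    f: "\<forall>b\<in>B. f b < m" "\<forall>i<m. card {b\<in>B. f b = i} = card {p\<in>Q. r p = i} + n i" by blast
  \<comment> \<open>A feasible start: every point of \<open>Q\<close> takes some index with negative
    \<open>D\<close>, and the points of \<open>B\<close> are then distributed with surplus
    \<open>n i\<close>.\<close>
  define a0 where "a0 p = (if p \<in> B then f p else r p)" for p
  have net: "(\<Sum>p | p \<in> X \<and> a p = i. s p) = real (card {b\<in>B. a b = i}) - real (card {p\<in>Q. a p = i})"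
    for a :: "'p \<Rightarrow> nat" and i
  proof -
    have e: "{p. p \<in> X \<and> a p = i} = {b\<in>B. a b = i} \<union> {p\<in>Q. a p = i}" unfolding X_def by auto
    have "(\<Sum>p | p \<in> X \<and> a p = i. s p) = (\<Sum>p | p \<in> B \<and> a p = i. s p) + (\<Sum>p | p \<in> Q \<and> a p = i. s p)"
      unfolding e using fin dis by (intro sum.union_disjoint) auto
    also have "(\<Sum>p | p \<in> B \<and> a p = i. s p) = (\<Sum>p | p \<in> B \<and> a p = i. 1)"
      by (intro sum.cong) (auto simp: s_def)
    also have "(\<Sum>p | p \<in> Q \<and> a p = i. s p) = (\<Sum>p | p \<in> Q \<and> a p = i. - 1)"
      using dis by (intro sum.cong) (auto simp: s_def)
    finally show ?thesis by simp
  qed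
  have "\<exists>a u. (\<forall>p\<in>X. a p \<in> {..<m} \<and> ok (a p) p)
     \<and> (\<forall>i\<in>{..<m}. (\<Sum>p | p \<in> X \<and> a p = i. s p) = (\<Sum>p | p \<in> X \<and> a0 p = i. s p))
     \<and> (\<forall>p\<in>X. \<forall>j\<in>{..<m}. ok j p \<longrightarrow> c (a p) p + s p * u (a p) \<le> c j p + s p * u j)"
  proof (rule optimal_assignment)
    show "finite X" using fin X_def by simp
    show "s p = 1 \<or> s p = - 1" for p by (simp add: s_def)
    show "a0 p \<in> {..<m} \<and> ok (a0 p) p" if "p \<in> X" for p
      using that f(1) r unfolding a0_def ok_def X_def by auto
  qed simp
  then obtain a u where au: "\<forall>p\<in>X. a p \<in> {..<m} \<and> ok (a p) p"
      "\<forall>i\<in>{..<m}. (\<Sum>p | p \<in> X \<and> a p = i. s p) = (\<Sum>p | p \<in> X \<and> a0 p = i. s p)"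
      "\<forall>p\<in>X. \<forall>j\<in>{..<m}. ok j p \<longrightarrow> c (a p) p + s p * u (a p) \<le> c j p + s p * u j"
    by blast
  have a: "a p < m" "ok (a p) p" if "p \<in> X" for p using au(1) that by blast+
  have bal: "(\<Sum>p | p \<in> X \<and> a p = i. s p) = (\<Sum>p | p \<in> X \<and> a0 p = i. s p)" if "i < m" for i
    using au(2) that by blast
  have opt: "c (a p) p + s p * u (a p) \<le> c j p + s p * u j" if "p \<in> X" "j < m" "ok j p" for p j
    using au(3) that by blast
  have "exp (u (a p)) * D (a p) p \<le> exp (u j) * D j p" if p: "p \<in> X" and j: "j < m" for p j
  proof (cases "p \<in> B")
    case True
    then have pos: "D (a p) p > 0" "D j p > 0" using B a(1)[OF p] j by auto
    have "ln (D (a p) p) + u (a p) \<le> ln (D j p) + u j"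
      using opt[OF p j] True unfolding ok_def c_def s_def by simp
    then have "exp (ln (D (a p) p) + u (a p)) \<le> exp (ln (D j p) + u j)" by simp
    then show ?thesis using pos by (simp add: exp_add mult.commute)
  next
    case False
    then have n: "D (a p) p < 0" using a(2)[OF p] ok_def by auto
    show ?thesis
    proof (cases "D j p < 0")
      case True
      then have "- ln (- D (a p) p) - u (a p) \<le> - ln (- D j p) - u j"
        using opt[OF p j] False unfolding ok_def c_def s_def by simp
      then have "exp (ln (- D j p) + u j) \<le> exp (ln (- D (a p) p) + u (a p))" by simp
      then show ?thesis using n True by (simp add: exp_add mult.commute)
    next
      case False
      then have "0 \<le> exp (u j) * D j p" by simp
      moreover have "exp (u (a p)) * D (a p) p \<le> 0" using n by (simp add: mult_nonneg_nonpos)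
      ultimately show ?thesis by linarith
    qed
  qed
  moreover have "card {b\<in>B. a b = i} = card {p\<in>Q. a p = i} + n i" if i: "i < m" for i
  proof -
    have "{b\<in>B. a0 b = i} = {b\<in>B. f b = i}" "{p\<in>Q. a0 p = i} = {p\<in>Q. r p = i}"
      using dis unfolding a0_def by auto
    then have "real (card {b\<in>B. a b = i}) - real (card {p\<in>Q. a p = i}) = real (n i)"
      using bal[OF i] f(2) i unfolding net by simp
    then show ?thesis by linarith
  qed
  moreover have "\<forall>p\<in>Q. D (a p) p < 0" using a(2) dis unfolding ok_def X_def by auto
  ultimately show ?thesis using a(1) unfolding X_def
    by (intro exI[of _ a] exI[of _ "\<lambda>i. exp (u i)"]) auto
qed

section \<open>Paths through the cells\<close>

lemma successively_iff_path_edges: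
  "successively P xs \<longleftrightarrow> (\<forall>e\<in>path_edges xs. P (fst e) (snd e))"
  by (induction xs rule: induct_list012) auto

text \<open>The functions \<open>g\<close> and \<open>h\<close> bound the cell at \<open>v\<close>
  and at \<open>w\<close>. Through the four-point identity, \<open>g\<close> makes \<open>v\<close>
  an end of the first bridge, and \<open>h\<close> gives \<open>w\<close> the condition under which
  \<open>zigzag\<close> visits it last in its colour. The set \<open>A'\<close> may omit
  \<open>w\<close>, as happens in the last cell when the round closes.\<close>

lemma cell_path:
  fixes A B A' :: "(real^2) set"
  assumes fin: "finite A" "finite B" and dis: "A \<inter> B = {}" and vw: "v \<noteq> w" "v \<notin> A \<union> B" "w \<notin> A \<union> B"
    and gp: "gen_pos (A \<union> B \<union> {v, w})"
    and A: "\<And>p. p \<in> A \<Longrightarrow> orient v w p \<le> 0" and B: "\<And>p. p \<in> B \<Longrightarrow> orient v w p > 0"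
    and g: "affine_fun g" "\<And>p. p \<in> A \<union> B \<Longrightarrow> g p \<ge> 0" "g v = 0" "g w > 0"
    and h: "affine_fun h" "\<And>p. p \<in> A \<union> B \<Longrightarrow> h p \<ge> 0" "h w = 0" "h v > 0"
    and A': "insert v A \<subseteq> A'" "A' \<subseteq> insert v (insert w A)"
    and crd: "card A' = card B \<or> card A' = Suc (card B)"
  shows "\<exists>xs. xs \<noteq> [] \<and> set xs = A' \<union> B \<and> distinct xs \<and> hd xs = v
    \<and> path_edges xs \<subseteq> A' \<times> B \<union> B \<times> A' \<and> noncrossing (path_edges xs)
    \<and> (card A' = card B \<and> w \<in> A' \<longrightarrow> (\<exists>ys z. z \<in> B \<and> xs = ys @ [w, z]))
    \<and> (card A' = Suc (card B) \<and> w \<in> A' \<longrightarrow> last xs = w)"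
proof -
  have A'A: "p = v \<or> p = w \<or> p \<in> A" if "p \<in> A'" for p using that A' by blast
  have dis': "A' \<inter> B = {}" using A'A dis vw by blast
  have gp': "gen_pos (A' \<union> B)" using A' by (intro gen_pos_mono[OF gp]) blast
  have finA': "finite A'" using A'(2) fin finite_subset by auto
  have vA': "v \<in> A'" using A' by blast
  have neg: "orient v w p \<le> 0" if "p \<in> A'" for p using A'A[OF that] A by auto
  have gA': "g p \<ge> 0" if "p \<in> A' \<union> B" for p using that A'A[of p] g by auto
  have hA': "h p \<ge> 0" if "p \<in> A' \<union> B" for p using that A'A[of p] h by auto
  \<comment> \<open>The vertices \<open>v\<close> and \<open>w\<close> lie on the side line itself,
    so the line is shifted slightly towards \<open>B\<close> to separate the colours
    strictly.\<close>
  obtain e where e: "e > 0" "\<And>p. p \<in> B \<Longrightarrow> orient v w p > e"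
  proof (cases "B = {}")
    case True
    then show ?thesis using that[of 1] by simp
  next
    case False
    define e where "e = Min (orient v w ` B)"
    have "e \<in> orient v w ` B" unfolding e_def using fin False by simp
    then have "e > 0" using B by auto
    moreover have "e \<le> orient v w p" if "p \<in> B" for p unfolding e_def using fin that by simp
    ultimately show ?thesis using that[of "e / 2"] by fastforce
  qed
  define d where "d x = orient v w x - e" for x
  have aff: "affine_fun d" unfolding d_def
    by (intro affine_fun_diff affine_fun_orient affine_fun_const)
  have dneg: "\<forall>p\<in>A'. d p < 0" using neg e(1) unfolding d_def by fastforce
  have dpos: "\<forall>p\<in>B. d p > 0" using e(2) unfolding d_def by fastforce
  have rot: "orient p v w = orient v w p" "orient p w v = - orient v w p" for p
    unfolding orient_def by algebra+
  have "\<exists>xs. xs \<noteq> [] \<and> set xs = A' \<union> B \<and> distinct xs \<and> hd xs = v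
    \<and> successively (\<lambda>x y. x \<in> A' \<and> y \<in> B \<or> x \<in> B \<and> y \<in> A') xs
    \<and> noncrossing (path_edges xs)
    \<and> (card A' = card B \<longrightarrow> last xs \<in> B) \<and> (card A' = Suc (card B) \<longrightarrow> last xs \<in> A')
    \<and> (w \<in> A' \<union> B \<longrightarrow> last xs = w \<or> (\<exists>ys z. xs = ys @ [w, z]))"
  \<comment> \<open>With \<open>s = - 1\<close> the remaining points lie to the right of each bridge
    directed from \<open>A'\<close> to \<open>B\<close>: the path sweeps from \<open>v\<close>
    towards \<open>w\<close>.\<close>
  proof (rule zigzag[where d = d and s = "- 1", OF finA' fin(2) dis' gp' aff dneg dpos _ vA' crd])
    show "B \<noteq> {} \<longrightarrow> (\<exists>b\<in>B. \<forall>p\<in>A' \<union> B - {v, b}. - 1 * orient v b p > 0)"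
    proof
      assume "B \<noteq> {}"
      then obtain a b where ab: "a \<in> A'" "b \<in> B" "\<And>p. p \<in> A' \<union> B - {a, b} \<Longrightarrow> - 1 * orient a b p > 0"
        using bridge_exists[OF finA' fin(2) _ _ dis' gp' aff dneg dpos, of "- 1"] vA' by blast
      \<comment> \<open>Otherwise the four-point identity for \<open>a\<close>, \<open>b\<close>,
        \<open>v\<close>, \<open>w\<close> would express zero as a sum of nonnegative terms, one of
        them positive.\<close>
      have "a = v"
      proof (rule ccontr)
        assume "a \<noteq> v"
        then have "orient a b v < 0" using ab(3)[of v] vA' ab(2) dis' by force
        then have "g w * orient a b v < 0" using g(4) by (simp add: mult_pos_neg)
        moreover have "g a * orient v w b - g b * orient v w a - g w * orient a b v = 0"
          using affine_fun_four_points[OF g(1), of a b v w] g(3) unfolding rot by simp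
        moreover have "g a * orient v w b \<ge> 0" using gA'[of a] B[of b] ab by (simp add: less_imp_le)
        moreover have "g b * orient v w a \<le> 0" using gA'[of b] neg[of a] ab by (simp add: mult_nonneg_nonpos)
        ultimately show False by linarith
      qed
      then show "\<exists>b\<in>B. \<forall>p\<in>A' \<union> B - {v, b}. - 1 * orient v b p > 0" using ab by blast
    qed
    show "w \<in> A' \<union> B \<longrightarrow> (\<forall>x\<in>A'. \<forall>y\<in>B. x \<noteq> w \<and> y \<noteq> w \<longrightarrow> - 1 * orient x y w > 0)"
    proof (intro impI ballI)
      fix x y assume xy: "x \<in> A'" "y \<in> B" "x \<noteq> w \<and> y \<noteq> w" and wA: "w \<in> A' \<union> B"
      have "- (h x * orient v w y) + h y * orient v w x - h v * orient x y w = 0"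
        using affine_fun_four_points[OF h(1), of x y w v] h(3) unfolding rot by simp
      moreover have "h x * orient v w y \<ge> 0" using hA'[of x] B[of y] xy by (simp add: less_imp_le)
      moreover have "h y * orient v w x \<le> 0" using hA'[of y] neg[of x] xy by (simp add: mult_nonneg_nonpos)
      ultimately have "h v * orient x y w \<le> 0" by linarith
      then have "orient x y w \<le> 0" using h(4) by (simp add: mult_le_0_iff)
      moreover have "orient x y w \<noteq> 0" using xy wA dis' by (intro gen_posD[OF gp']) auto
      ultimately show "- 1 * orient x y w > 0" by simp
    qed
  qed simp
  then obtain xs where xs: "xs \<noteq> []" "set xs = A' \<union> B" "distinct xs" "hd xs = v"
    "successively (\<lambda>x y. x \<in> A' \<and> y \<in> B \<or> x \<in> B \<and> y \<in> A') xs" "noncrossing (path_edges xs)"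
    "card A' = card B \<longrightarrow> last xs \<in> B" "card A' = Suc (card B) \<longrightarrow> last xs \<in> A'"
    "w \<in> A' \<union> B \<longrightarrow> last xs = w \<or> (\<exists>ys z. xs = ys @ [w, z])" by blast
  have ed: "path_edges xs \<subseteq> A' \<times> B \<union> B \<times> A'"
    using xs(5) unfolding successively_iff_path_edges by fastforce
  \<comment> \<open>\<open>zigzag\<close> leaves \<open>w\<close> in the last or the last but one
    position; the colour of the final point, known from the cardinalities, decides which.\<close>
  have last1: "\<exists>ys z. z \<in> B \<and> xs = ys @ [w, z]" if c: "card A' = card B" and w: "w \<in> A'"
  proof -
    have "last xs \<in> B" using xs(7) c by blast
    moreover then have "last xs \<noteq> w" using w dis' by blast
    ultimately show ?thesis using xs(9) w by fastforce
  qed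
  have last2: "last xs = w" if c: "card A' = Suc (card B)" and w: "w \<in> A'"
  proof (rule ccontr)
    assume "last xs \<noteq> w"
    then obtain ys z where z: "xs = ys @ [w, z]" using xs(9) w by blast
    then have "(w, z) \<in> path_edges xs" by (cases "ys = []") (simp_all add: path_edges_append)
    then have "z \<in> B" using ed w dis' by blast
    then show False using xs(8) c z dis' by auto
  qed
  show ?thesis using xs ed last1 last2 by blast
qed

lemma noncrossing_Un:
  assumes "noncrossing E" "noncrossing F" "\<And>e f. e \<in> E \<Longrightarrow> f \<in> F \<Longrightarrow> seg_compat e f"
  shows "noncrossing (E \<union> F)"
  using assms seg_compat_sym unfolding noncrossing_def by blast

lemma seg_compat_flip: "seg_compat (p, q) f \<Longrightarrow> seg_compat (q, p) f"
  unfolding seg_compat_def by (simp add: closed_segment_commute insert_commute)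

text \<open>As the vertices are distinct, consecutive edges have one common endpoint and other pairs
  of edges have none, so compatibility of edges gives both clauses on indices.\<close>

lemma alternating_Hamiltonian_pathI:
  assumes ne: "xs \<noteq> []" and st: "set xs = R \<union> B" and di: "distinct xs"
    and ed: "path_edges xs \<subseteq> R \<times> B \<union> B \<times> R" and nc: "noncrossing (path_edges xs)"
  shows "alternating_Hamiltonian_path R B xs"
proof -
  have pe: "(xs ! i, xs ! Suc i) \<in> path_edges xs" if "Suc i < length xs" for i
    using that unfolding path_edges_def in_set_zip by (auto intro!: exI[of _ i] simp: nth_tl)
  have int: "path_edge xs i \<inter> path_edge xs j \<subseteq> {xs ! i, xs ! Suc i} \<inter> {xs ! j, xs ! Suc j}"
    if "i < j" "Suc j < length xs" for i j
  proof -
    have "xs ! i \<noteq> xs ! j" using that di by (simp add: nth_eq_iff_index_eq)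
    then have "seg_compat (xs ! i, xs ! Suc i) (xs ! j, xs ! Suc j)"
      using nc pe[of i] pe[of j] that unfolding noncrossing_def by auto
    then show ?thesis unfolding seg_compat_def path_edge_def by simp
  qed
  have "non_self_intersecting xs"
    unfolding non_self_intersecting_def
  proof (intro conjI allI impI di)
    fix i assume i: "Suc (Suc i) < length xs"
    have "path_edge xs i \<inter> path_edge xs (Suc i) \<subseteq> {xs ! Suc i}"
      using int[of i "Suc i"] i di by (auto simp: nth_eq_iff_index_eq)
    moreover have "xs ! Suc i \<in> path_edge xs i \<inter> path_edge xs (Suc i)" unfolding path_edge_def by simp
    ultimately show "path_edge xs i \<inter> path_edge xs (Suc i) = {xs ! Suc i}" by blast
  next
    fix i j assume ij: "Suc i < j \<and> Suc j < length xs"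
    then have "{xs ! i, xs ! Suc i} \<inter> {xs ! j, xs ! Suc j} = {}"
      using di by (auto simp: nth_eq_iff_index_eq)
    then show "path_edge xs i \<inter> path_edge xs j = {}" using int[of i j] ij by auto
  qed
  then show ?thesis unfolding alternating_Hamiltonian_path_def alternating_path_def
    using ne st ed pe by blast
qed

section \<open>Joining the cell paths around the polygon\<close>

lemma mod_Suc_cases: "i < m \<Longrightarrow> Suc i mod m = (if Suc i = m then 0 else Suc i)" for m :: nat
  by auto

theorem theorem1:
  fixes R B P :: "(real^2) set"
  assumes "finite R" and "finite B"
    and "R \<inter> B = {}"
    and "general_position (R \<union> B)"
    and "convex_polygon P"
    and "polygon_vertices P \<subseteq> R"
    and "\<forall>r \<in> R - polygon_vertices P. r \<notin> P"
    and "B \<subseteq> interior P"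
    and "\<bar>int (card R) - int (card B)\<bar> \<le> 1"
  shows "\<exists>xs. alternating_Hamiltonian_path R B xs"
proof -
  note finR = assms(1) and finB = assms(2) and dis = assms(3) and VR = assms(6)
  have gp: "gen_pos (R \<union> B)" by (rule gen_pos_if_general_position[OF assms(4)])
  have "gen_pos (polygon_vertices P)" using VR by (intro gen_pos_mono[OF gp]) blast
  from polygon_sides[OF assms(5) this] obtain vs where
    vs: "set vs = polygon_vertices P" "distinct vs" and len: "3 \<le> length vs"
    and side: "\<And>i j. i < length vs \<Longrightarrow> j < length vs \<Longrightarrow> j \<noteq> i \<Longrightarrow> j \<noteq> Suc i mod length vs \<Longrightarrow>
        orient (vs ! i) (vs ! (Suc i mod length vs)) (vs ! j) > 0"
    and outside: "\<And>x. (\<And>i. i < length vs \<Longrightarrow> orient (vs ! i) (vs ! (Suc i mod length vs)) x \<ge> 0) \<Longrightarrow> x \<in> P"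
    and inside: "\<And>x i. x \<in> interior P \<Longrightarrow> i < length vs \<Longrightarrow>
        orient (vs ! i) (vs ! (Suc i mod length vs)) x > 0"
    by blast
  define m where "m = length vs"
  define nx where "nx i = Suc i mod m" for i
  define v where "v i = vs ! i" for i
  define D where "D i = orient (v i) (v (nx i))" for i
  define Q where "Q = R - set vs"
  have m3: "3 \<le> m" using len m_def by simp
  have nx_lt: "nx i < m" if "i < m" for i using that m3 unfolding nx_def by simp
  have nx_Suc: "nx i = Suc i" if "Suc i < m" for i using that unfolding nx_def by simp
  have nx_last: "nx (m - 1) = 0" using m3 unfolding nx_def by simp
  have nx_neq: "nx i \<noteq> i" if "i < m" for i
    using that m3 unfolding nx_def by (auto simp: mod_Suc_cases)
  have nx_nx_neq: "nx (nx i) \<noteq> i" if "i < m" for i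
    using that m3 unfolding nx_def by (auto simp: mod_Suc_cases)
  have v_inj: "v i = v j \<longleftrightarrow> i = j" if "i < m" "j < m" for i j
    using that vs(2) unfolding v_def m_def by (simp add: nth_eq_iff_index_eq)
  have v_set: "v i \<in> set vs" if "i < m" for i using that unfolding v_def m_def by simp
  have set_vs: "set vs = v ` {..<m}" unfolding v_def m_def by (auto simp: set_conv_nth)
  have VR': "set vs \<subseteq> R" using VR vs by simp
  have finQ: "finite Q" using finR Q_def by simp
  have disQ: "Q \<inter> B = {}" "Q \<inter> set vs = {}" "B \<inter> set vs = {}" using dis VR' Q_def by auto
  have D_aff: "affine_fun (D i)" for i unfolding D_def by (rule affine_fun_orient)
  have D_v: "D i (v j) > 0" if "i < m" "j < m" "j \<noteq> i" "j \<noteq> nx i" for i j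
    using side[of i j] that unfolding D_def v_def m_def nx_def by simp
  have D_0: "D i (v i) = 0" "D i (v (nx i)) = 0" for i unfolding D_def by simp_all
  have D_B: "D i b > 0" if "b \<in> B" "i < m" for i b
    using inside[of b i] that assms(8) unfolding D_def v_def m_def nx_def by blast
  have D_Q: "\<exists>i<m. D i r < 0" if "r \<in> Q" for r
  proof (rule ccontr)
    assume "\<not> ?thesis"
    then have "\<And>i. i < m \<Longrightarrow> 0 \<le> D i r" using not_less by blast
    then have "r \<in> P" using outside[of r] unfolding D_def v_def m_def nx_def by blast
    then show False using that assms(7) vs(1) unfolding Q_def by blast
  qed
  have card_R: "card R = m + card Q"
    using card_Diff_subset[of "set vs" R] VR' distinct_card[OF vs(2)] card_mono[OF finR VR']
    unfolding Q_def m_def by simp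
  \<comment> \<open>A path from \<open>v i\<close> to \<open>v (nx i)\<close> with both ends red
    needs a surplus of one. The last cell takes the rest, \<open>card B - card Q - (m - 1)\<close>;
    the truncated subtraction is exact because \<open>card R\<close> is at most
    \<open>card B + 1\<close>, and the value is 0, 1 or 2.\<close>
  define n where "n i = (if i = m - 1 then card B + 1 - card R else 1)" for i
  have n_last: "n (m - 1) = card B + 1 - card R" "card R \<le> card B + 1" "n (m - 1) \<le> 2"
    using assms(9) unfolding n_def by auto
  have "(\<Sum>i<m. n i) = (\<Sum>i<m - 1. n i) + n (m - 1)"
    using m3 sum.lessThan_Suc[of n "m - 1"] by simp
  also have "(\<Sum>i<m - 1. n i) = m - 1" by (simp add: n_def)
  finally have "card B = card Q + (\<Sum>i<m. n i)" using card_R n_last m3 by simp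
  then have "\<exists>a l. (\<forall>i. l i > 0) \<and>
      (\<forall>p\<in>Q \<union> B. a p < m \<and> (\<forall>j<m. l (a p) * D (a p) p \<le> l j * D j p)) \<and>
      (\<forall>r\<in>Q. D (a r) r < 0) \<and>
      (\<forall>i<m. card {b\<in>B. a b = i} = card {r\<in>Q. a r = i} + n i)"
    using D_B D_Q by (intro balanced_cells[OF finQ finB disQ(1)]) blast+
  then obtain a l where l: "\<And>i. l i > 0" and a: "\<And>p. p \<in> Q \<union> B \<Longrightarrow> a p < m"
    and cell: "\<And>p j. p \<in> Q \<union> B \<Longrightarrow> j < m \<Longrightarrow> l (a p) * D (a p) p \<le> l j * D j p"
    and below: "\<And>r. r \<in> Q \<Longrightarrow> D (a r) r < 0"
    and crd: "\<And>i. i < m \<Longrightarrow> card {b\<in>B. a b = i} = card {r\<in>Q. a r = i} + n i"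
    by blast
  define H where "H i x = l i * D i x" for i x
  define QQ where "QQ i = {r\<in>Q. a r = i}" for i
  define BB where "BB i = {b\<in>B. a b = i}" for i
  define RR where "RR i = QQ i \<union> {v i, v (nx i)}" for i
  define EE where "EE i = RR i \<times> BB i \<union> BB i \<times> RR i" for i
  have H_aff: "affine_fun (\<lambda>x. H j x - H i x)" for i j
    unfolding H_def by (intro affine_fun_diff affine_fun_mult D_aff)
  have H_0: "H i (v i) = 0" "H i (v (nx i)) = 0" for i unfolding H_def by (simp_all add: D_0)
  have H_v: "H i (v j) > 0" if "i < m" "j < m" "j \<noteq> i" "j \<noteq> nx i" for i j
    unfolding H_def using l D_v that by simp
  have H_v': "H i (v j) \<ge> 0" if "i < m" "j < m" for i j
    using H_v[OF that] H_0 by (cases "j = i \<or> j = nx i") auto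
  have RB: "RR i \<subseteq> R" "BB i \<subseteq> B" if "i < m" for i
    using VR' v_set[OF that] v_set[OF nx_lt[OF that]] unfolding RR_def QQ_def BB_def Q_def by auto
  \<comment> \<open>The two vertices of side \<open>i\<close> belong to its cell too: there
    \<open>H i\<close> is zero and every other \<open>H j\<close> is nonnegative.\<close>
  have H_cell: "H i p \<le> H j p" if ij: "i < m" "j < m" and p: "p \<in> RR i \<union> BB i" for i j p
  proof -
    consider "p = v i" | "p = v (nx i)" | "p \<in> Q \<union> B" "a p = i"
      using p unfolding RR_def QQ_def BB_def by blast
    then show ?thesis
    proof cases
      case 1
      then show ?thesis using H_0(1)[of i] H_v'[OF ij(2,1)] by simp
    next
      case 2
      then show ?thesis using H_0(2)[of i] H_v'[OF ij(2) nx_lt[OF ij(1)]] by simp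
    next
      case 3
      then show ?thesis using cell[of p j] ij unfolding H_def by simp
    qed
  qed
  have fin: "finite (QQ i)" "finite (BB i)" for i using finQ finB unfolding QQ_def BB_def by auto
  \<comment> \<open>\<open>H j - H i\<close> weakly separates the two cells. If it vanished at all
    four endpoints, three noncollinear zeros would make \<open>H i\<close> and \<open>H j\<close>
    equal everywhere, so sides \<open>i\<close> and \<open>j\<close> would have both vertices in
    common.\<close>
  have cross: "seg_compat e f" if ij: "i < m" "j < m" "i \<noteq> j" and e: "e \<in> EE i" and f: "f \<in> EE j" for i j e f
  proof -
    obtain p q p' q' where pq: "e = (p, q)" "f = (p', q')" by (cases e; cases f)
    have mem: "p \<in> RR i \<union> BB i" "q \<in> RR i \<union> BB i" "p' \<in> RR j \<union> BB j" "q' \<in> RR j \<union> BB j"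
      using e f pq unfolding EE_def by auto
    have "\<not> (H j p - H i p = 0 \<and> H j q - H i q = 0 \<and> H j p' - H i p' = 0 \<and> H j q' - H i q' = 0)"
    proof
      assume z: "H j p - H i p = 0 \<and> H j q - H i q = 0 \<and> H j p' - H i p' = 0 \<and> H j q' - H i q' = 0"
      \<comment> \<open>A red endpoint may be a vertex shared by both cells, but a blue point
        belongs to only one cell, so \<open>b\<close> differs from \<open>p\<close> and
        \<open>q\<close>.\<close>
      obtain b where b: "b = p' \<or> b = q'" "b \<in> BB j" using f pq unfolding EE_def by auto
      have "p \<noteq> q" using e pq RB[OF ij(1)] dis unfolding EE_def by auto
      moreover have "b \<noteq> p \<and> b \<noteq> q"
        using mem b ij RB[OF ij(1)] RB[OF ij(2)] dis unfolding BB_def by auto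
      ultimately have o: "orient p q b \<noteq> 0"
        using mem(1,2) b(2) RB ij(1,2) by (intro gen_posD[OF gp]) blast+
      have "H j b - H i b = 0" using z b(1) by auto
      then have "(H j x - H i x) * orient p q b = 0" for x
        using affine_fun_four_points[OF H_aff[of j i], of x p q b] z by simp
      then have hz: "H j x = H i x" for x using o by simp
      have "i = j \<or> i = nx j"
        using hz[of "v i"] H_0(1)[of i] H_v[of j i] ij by fastforce
      moreover have "nx i = j \<or> nx i = nx j"
        using hz[of "v (nx i)"] H_0(2)[of i] H_v[of j "nx i"] ij nx_lt by fastforce
      ultimately show False using ij nx_neq nx_nx_neq by metis
    qed
    moreover have "H j p - H i p \<ge> 0" "H j q - H i q \<ge> 0" "H j p' - H i p' \<le> 0" "H j q' - H i q' \<le> 0"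
      using H_cell[OF ij(1,2)] H_cell[OF ij(2,1)] mem by simp_all
    moreover have "p \<in> R \<union> B" "q \<in> R \<union> B" "p' \<in> R \<union> B" "q' \<in> R \<union> B"
      using mem RB[OF ij(1)] RB[OF ij(2)] by blast+
    ultimately show ?thesis unfolding pq
      by (intro seg_compat_affine[OF gp _ _ _ _ H_aff[of j i]])
  qed
  have path: "\<exists>xs. xs \<noteq> [] \<and> set xs = A' \<union> BB i \<and> distinct xs \<and> hd xs = v i
    \<and> path_edges xs \<subseteq> A' \<times> BB i \<union> BB i \<times> A' \<and> noncrossing (path_edges xs)
    \<and> (card A' = card (BB i) \<and> v (nx i) \<in> A' \<longrightarrow> (\<exists>ys z. z \<in> BB i \<and> xs = ys @ [v (nx i), z]))
    \<and> (card A' = Suc (card (BB i)) \<and> v (nx i) \<in> A' \<longrightarrow> last xs = v (nx i))"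
    if i: "i < m" and A': "insert (v i) (QQ i) \<subseteq> A'" "A' \<subseteq> insert (v i) (insert (v (nx i)) (QQ i))"
      "card A' = card (BB i) \<or> card A' = Suc (card (BB i))" for i A'
  proof -
    \<comment> \<open>The preceding side, which meets side \<open>i\<close> in \<open>v i\<close>;
      the comparisons with it and with the next side supply \<open>g\<close> and
      \<open>h\<close>.\<close>
    define pr where "pr = (if i = 0 then m - 1 else i - 1)"
    have pr: "pr < m" "nx pr = i" using i m3 nx_last nx_Suc[of "i - 1"] unfolding pr_def by auto
    have ni: "nx i < m" using nx_lt i by simp
    show ?thesis
    proof (rule cell_path[where g = "\<lambda>x. H pr x - H i x" and h = "\<lambda>x. H (nx i) x - H i x"])
      show "finite (QQ i)" "finite (BB i)" using fin by auto
      show "QQ i \<inter> BB i = {}" using disQ unfolding QQ_def BB_def by auto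
      show "v i \<noteq> v (nx i)" using v_inj i ni nx_neq by metis
      show "v i \<notin> QQ i \<union> BB i" "v (nx i) \<notin> QQ i \<union> BB i"
        using v_set[OF i] v_set[OF ni] disQ unfolding QQ_def BB_def by auto
      show "gen_pos (QQ i \<union> BB i \<union> {v i, v (nx i)})"
        using RB[OF i] unfolding RR_def by (intro gen_pos_mono[OF gp]) auto
      show "orient (v i) (v (nx i)) p \<le> 0" if "p \<in> QQ i" for p
        using below that unfolding QQ_def D_def by fastforce
      show "orient (v i) (v (nx i)) p > 0" if "p \<in> BB i" for p
        using D_B i that unfolding BB_def D_def by blast
      show "affine_fun (\<lambda>x. H pr x - H i x)" "affine_fun (\<lambda>x. H (nx i) x - H i x)"
        by (rule H_aff)+
      show "0 \<le> H pr p - H i p" "0 \<le> H (nx i) p - H i p" if "p \<in> QQ i \<union> BB i" for p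
        using H_cell[OF i pr(1), of p] H_cell[OF i ni, of p] that unfolding RR_def by auto
      show "H pr (v i) - H i (v i) = 0" using H_0(1)[of i] H_0(2)[of pr] pr(2) by simp
      show "H (nx i) (v (nx i)) - H i (v (nx i)) = 0" by (simp add: H_0)
      show "H pr (v (nx i)) - H i (v (nx i)) > 0"
        using H_v[OF pr(1) ni] H_0(2)[of i] nx_neq[OF i] nx_nx_neq[OF pr(1)] pr(2) by auto
      show "H (nx i) (v i) - H i (v i) > 0"
        using H_v[OF ni i] H_0(1)[of i] nx_neq[OF i] nx_nx_neq[OF i] by auto
    qed (use A' in auto)
  qed
  have card_BB: "card (BB i) = card (QQ i) + n i" if "i < m" for i
    using crd[OF that] unfolding BB_def QQ_def .
  have card_QQ1: "card (insert (v i) (QQ i)) = Suc (card (QQ i))" if "i < m" for i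
    using fin v_set[OF that] disQ unfolding QQ_def by (subst card_insert_disjoint) auto
  have card_RR: "card (RR i) = Suc (Suc (card (QQ i)))" if "i < m" for i
  proof -
    have "RR i = insert (v (nx i)) (insert (v i) (QQ i))" unfolding RR_def by auto
    moreover have "v (nx i) \<notin> insert (v i) (QQ i)"
      using v_set[OF nx_lt[OF that]] disQ v_inj[OF nx_lt[OF that] that] nx_neq[OF that]
      unfolding QQ_def by auto
    ultimately show ?thesis using card_QQ1[OF that] fin by simp
  qed
  \<comment> \<open>The last cell is left out, since its path would return to \<open>v 0\<close>.
    Each join drops the head of the new path, which repeats the last vertex.\<close>
  have chain: "\<exists>xs. xs \<noteq> [] \<and> distinct xs \<and> hd xs = v 0 \<and> last xs = v k
      \<and> set xs = (\<Union>i<k. QQ i \<union> BB i) \<union> v ` {..k}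
      \<and> path_edges xs \<subseteq> (\<Union>i<k. EE i) \<and> noncrossing (path_edges xs)" if "k < m" for k
    using that
  proof (induction k)
    case 0
    show ?case by (intro exI[of _ "[v 0]"]) (simp add: noncrossing_def)
  next
    case (Suc k)
    then have k: "k < m" "nx k = Suc k" "n k = 1" using nx_Suc unfolding n_def by auto
    obtain xs where xs: "xs \<noteq> []" "distinct xs" "hd xs = v 0" "last xs = v k"
      "set xs = (\<Union>i<k. QQ i \<union> BB i) \<union> v ` {..k}"
      "path_edges xs \<subseteq> (\<Union>i<k. EE i)" "noncrossing (path_edges xs)"
      using Suc by auto
    have "card (RR k) = Suc (card (BB k))" using card_RR card_BB k by simp
    then obtain ys where ys: "ys \<noteq> []" "set ys = RR k \<union> BB k" "distinct ys" "hd ys = v k"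
      "path_edges ys \<subseteq> EE k" "noncrossing (path_edges ys)" "last ys = v (Suc k)"
      using path[OF k(1), of "RR k"] k(2) unfolding RR_def EE_def by auto
    have tl: "set (tl ys) = QQ k \<union> BB k \<union> {v (Suc k)}"
    proof -
      have "set ys = insert (v k) (set (tl ys))" "v k \<notin> set (tl ys)"
        using ys(1,3,4) by (cases ys; simp)+
      moreover have "v k \<notin> QQ k \<union> BB k \<union> {v (Suc k)}"
        using v_set[OF k(1)] disQ v_inj[OF k(1) Suc.prems] unfolding QQ_def BB_def by auto
      moreover have "set ys = insert (v k) (QQ k \<union> BB k \<union> {v (Suc k)})"
        using ys(2) k(2) unfolding RR_def by auto
      ultimately show ?thesis using insert_ident by metis
    qed
    have "set xs \<inter> set (tl ys) = {}"
    proof -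
      have "(\<Union>i<k. QQ i \<union> BB i) \<inter> (QQ k \<union> BB k) = {}" using disQ unfolding QQ_def BB_def by auto
      moreover have "(\<Union>i<Suc k. QQ i \<union> BB i) \<inter> set vs = {}" using disQ unfolding QQ_def BB_def by auto
      moreover have "v ` {..Suc k} \<subseteq> set vs" using v_set Suc.prems by auto
      moreover have "v (Suc k) \<notin> v ` {..k}" using v_inj Suc.prems by auto
      ultimately show ?thesis unfolding xs(5) tl by (auto simp: lessThan_Suc atMost_Suc)
    qed
    then have "distinct (xs @ tl ys)" using xs(2) ys(3) by (simp add: distinct_tl)
    moreover have "set (xs @ tl ys) = (\<Union>i<Suc k. QQ i \<union> BB i) \<union> v ` {..Suc k}"
      using xs(5) tl by (auto simp: lessThan_Suc atMost_Suc)
    moreover have pe: "path_edges (xs @ tl ys) = path_edges xs \<union> path_edges ys"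
      using xs(1,4) ys(1,4) by (intro path_edges_join) simp_all
    moreover have "noncrossing (path_edges (xs @ tl ys))" unfolding pe
    proof (rule noncrossing_Un[OF xs(7) ys(6)])
      fix e f assume "e \<in> path_edges xs" "f \<in> path_edges ys"
      then obtain i where "i < k" "e \<in> EE i" "f \<in> EE k" using xs(6) ys(5) by blast
      then show "seg_compat e f" using cross[of i k] k(1) by auto
    qed
    moreover have "last (xs @ tl ys) = v (Suc k)"
    proof -
      have "tl ys \<noteq> []" using tl by auto
      then show ?thesis using ys(7) by (simp add: last_tl)
    qed
    ultimately show ?case using xs ys(5)
      by (intro exI[of _ "xs @ tl ys"]) (auto simp: lessThan_Suc)
  qed
  define k where "k = m - 1"
  have k: "k < m" "nx k = 0" "Suc k = m" "0 < k" using m3 nx_last unfolding k_def by auto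
  obtain xs where xs: "xs \<noteq> []" "distinct xs" "hd xs = v 0" "last xs = v k"
    "set xs = (\<Union>i<k. QQ i \<union> BB i) \<union> v ` {..k}"
    "path_edges xs \<subseteq> (\<Union>i<k. EE i)" "noncrossing (path_edges xs)"
    using chain[OF k(1)] by blast
  have vk: "v ` {..k} = set vs" unfolding set_vs using k by (simp add: lessThan_Suc_atMost[symmetric])
  have RB_eq: "R \<union> B = set xs \<union> QQ k \<union> BB k"
  proof -
    have "Q \<union> B = (\<Union>i<m. QQ i \<union> BB i)" using a unfolding QQ_def BB_def by auto
    also have "\<dots> = (\<Union>i<k. QQ i \<union> BB i) \<union> QQ k \<union> BB k"
      unfolding k(3)[symmetric] by (auto simp: lessThan_Suc)
    finally show ?thesis using VR' unfolding xs(5) vk Q_def by blast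
  qed
  have xs_disj: "set xs \<inter> (QQ k \<union> BB k) = {}"
    unfolding xs(5) vk using disQ unfolding QQ_def BB_def by auto
  have EE_RB: "EE i \<subseteq> R \<times> B \<union> B \<times> R" if "i < m" for i unfolding EE_def using RB[OF that] by (intro Un_mono Sigma_mono)
  have "EE i \<subseteq> R \<times> B \<union> B \<times> R" if "i < k" for i
    by (rule EE_RB) (use that k(1) in simp)
  then have "(\<Union>i<k. EE i) \<subseteq> R \<times> B \<union> B \<times> R" by (intro UN_least) simp
  then have xs_RB: "path_edges xs \<subseteq> R \<times> B \<union> B \<times> R" by (rule subset_trans[OF xs(6)])
  have nc: "noncrossing (path_edges xs \<union> path_edges ys)"
    if "path_edges ys \<subseteq> EE k" "noncrossing (path_edges ys)" for ys
  proof (rule noncrossing_Un[OF xs(7) that(2)])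
    fix e f assume e: "e \<in> path_edges xs" and f: "f \<in> path_edges ys"
    obtain i where i: "i < k" "e \<in> EE i" using subsetD[OF xs(6) e] by blast
    then have "i < m" "i \<noteq> k" using k(1) by simp_all
    then show "seg_compat e f" using cross[OF _ k(1) _ i(2) subsetD[OF that(1) f]] by blast
  qed
  have cBk: "card (BB k) = card (QQ k) + n k" using card_BB k by simp
  show ?thesis
  \<comment> \<open>With surplus 0 or 1 the last path starts at \<open>v k\<close> and omits the
    already visited \<open>v 0\<close>. With surplus 2 it needs \<open>v 0\<close> as an additional
    red point to match the blue ones.\<close>
  proof (cases "n k = 2")
    case False
    then have "n k = 0 \<or> n k = 1" using n_last(3) k_def by auto
    then have "card (insert (v k) (QQ k)) = card (BB k) \<or>
        card (insert (v k) (QQ k)) = Suc (card (BB k))"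
      using card_QQ1[OF k(1)] cBk by auto
    from path[OF k(1) _ _ this] obtain ys where ys: "ys \<noteq> []" "set ys = insert (v k) (QQ k) \<union> BB k"
      "distinct ys" "hd ys = v k"
      "path_edges ys \<subseteq> insert (v k) (QQ k) \<times> BB k \<union> BB k \<times> insert (v k) (QQ k)"
      "noncrossing (path_edges ys)" by blast
    have yE: "path_edges ys \<subseteq> EE k" using ys(5) unfolding EE_def RR_def by auto
    have tl: "set ys = insert (v k) (set (tl ys))" "v k \<notin> set (tl ys)"
      using ys(1,3,4) by (cases ys; simp)+
    have vkx: "v k \<in> set xs" unfolding xs(5) by auto
    then have "v k \<notin> QQ k \<union> BB k" using xs_disj by (metis IntI empty_iff)
    moreover have "insert (v k) (set (tl ys)) = insert (v k) (QQ k \<union> BB k)" using tl(1) ys(2) by simp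
    ultimately have tls: "set (tl ys) = QQ k \<union> BB k" using tl(2) insert_ident by metis
    have pe: "path_edges (xs @ tl ys) = path_edges xs \<union> path_edges ys"
      using xs(1,4) ys(1,4) by (intro path_edges_join) simp_all
    have "alternating_Hamiltonian_path R B (xs @ tl ys)"
    proof (rule alternating_Hamiltonian_pathI)
      show "xs @ tl ys \<noteq> []" using xs by simp
      show "set (xs @ tl ys) = R \<union> B" using RB_eq tls by auto
      show "distinct (xs @ tl ys)" using xs(2) ys(3) tls xs_disj by (auto simp: distinct_tl)
      show "path_edges (xs @ tl ys) \<subseteq> R \<times> B \<union> B \<times> R"
        unfolding pe using xs_RB subset_trans[OF yE EE_RB[OF k(1)]] by (rule Un_least)
      show "noncrossing (path_edges (xs @ tl ys))" unfolding pe by (rule nc[OF yE ys(6)])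
    qed
    then show ?thesis by blast
  next
    case True
    then have c: "card (RR k) = card (BB k)" using card_RR[OF k(1)] cBk by simp
    have sub: "insert (v k) (QQ k) \<subseteq> RR k" "RR k \<subseteq> insert (v k) (insert (v (nx k)) (QQ k))"
      "v (nx k) \<in> RR k" unfolding RR_def by auto
    obtain ys where ys: "set ys = RR k \<union> BB k"
      "distinct ys" "hd ys = v k" "path_edges ys \<subseteq> EE k"
      "noncrossing (path_edges ys)" and "\<exists>us z. z \<in> BB k \<and> ys = us @ [v (nx k), z]"
      using path[OF k(1) sub(1,2) disjI1[OF c]] c sub(3) unfolding EE_def by blast
    then obtain us z where z: "z \<in> BB k" "ys = us @ [v 0, z]" using k(2) by auto
    \<comment> \<open>The last path ends \<open>\<dots>, last us, v 0, z\<close> and so closes a cycle with a tail \<open>z\<close>; the edge from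
      \<open>last us\<close> to \<open>v 0\<close> is dropped.\<close>
    have v0k: "v 0 \<noteq> v k" using v_inj[of 0 k] k by auto
    then have us: "us \<noteq> []" "hd us = v k" using ys(3) z(2) by (cases us; auto)+
    have ed: "path_edges ys = path_edges us \<union> {(last us, v 0), (v 0, z)}"
      unfolding z(2) using us by (simp add: path_edges_append)
    have tl: "set us = insert (v k) (set (tl us))" "v k \<notin> set (tl us)"
      using us ys(2) z(2) by (cases us; simp)+
    have vkx: "v k \<in> set xs" "v 0 \<in> set xs" unfolding xs(5) by auto
    have tls: "insert z (set (tl us)) = QQ k \<union> BB k"
    proof -
      have "set ys = insert (v k) (insert (v 0) (QQ k \<union> BB k))" using ys(1) k(2) unfolding RR_def by auto
      moreover have "set ys = insert (v k) (insert (v 0) (insert z (set (tl us))))"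
        unfolding z(2) using tl by auto
      moreover have "v 0 \<notin> QQ k \<union> BB k" "v k \<notin> insert (v 0) (QQ k \<union> BB k)"
        using vkx xs_disj v0k by (metis IntI empty_iff insertE)+
      moreover have "z \<noteq> v k" "z \<noteq> v 0" using z(1) vkx xs_disj by (metis IntI UnI2 empty_iff)+
      then have "v 0 \<notin> insert z (set (tl us))" "v k \<notin> insert (v 0) (insert z (set (tl us)))"
        using tl ys(2) v0k unfolding z(2) by auto
      ultimately show ?thesis using insert_ident by metis
    qed
    have zus: "z \<notin> set us" using ys(2) unfolding z(2) by auto
    have zxs: "z \<notin> set xs" using z(1) xs_disj by blast
    have pe: "path_edges (xs @ tl us) = path_edges xs \<union> path_edges us"
      using xs(1,4) us by (intro path_edges_join) simp_all
    \<comment> \<open>The tail \<open>z\<close> becomes the new start: the path enters at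
      \<open>v 0\<close>, runs around to \<open>v k\<close> and finishes at
      \<open>last us\<close>.\<close>
    have pe': "path_edges (z # xs @ tl us) = insert (z, v 0) (path_edges xs \<union> path_edges us)"
      using path_edges_Cons[of "xs @ tl us" z] pe xs(1,3) by simp
    have all: "noncrossing (path_edges xs \<union> path_edges ys)" by (rule nc[OF ys(4,5)])
    have "alternating_Hamiltonian_path R B (z # xs @ tl us)"
    proof (rule alternating_Hamiltonian_pathI)
      show "z # xs @ tl us \<noteq> []" by simp
      show "set (z # xs @ tl us) = R \<union> B" using RB_eq tls by auto
      have "set xs \<inter> set (tl us) = {}" "z \<notin> set (tl us)" using xs_disj tls tl(1) zus by auto
      then show "distinct (z # xs @ tl us)" using xs(2) ys(2) z(2) zxs by (auto simp: distinct_tl)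
      have "(z, v 0) \<in> B \<times> R" using z(1) RB[OF k(1)] k(2) unfolding RR_def by auto
      then show "path_edges (z # xs @ tl us) \<subseteq> R \<times> B \<union> B \<times> R"
        unfolding pe' using xs_RB subset_trans[OF ys(4) EE_RB[OF k(1)]] ed by simp
      show "noncrossing (path_edges (z # xs @ tl us))" unfolding pe'
      proof (rule noncrossing_insert)
        show "noncrossing (path_edges xs \<union> path_edges us)"
          unfolding ed by (intro noncrossing_mono[OF all[unfolded ed]] Un_mono subset_refl Un_upper1)
        fix f assume f: "f \<in> path_edges xs \<union> path_edges us"
        then have "f \<noteq> (v 0, z)"
          using path_edges_subset[of xs] path_edges_subset[of us] zus zxs by auto
        moreover have "(v 0, z) \<in> path_edges xs \<union> path_edges ys" "f \<in> path_edges xs \<union> path_edges ys"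
          using f unfolding ed by auto
        \<comment> \<open>The edge between \<open>v 0\<close> and \<open>z\<close> is traversed
          against its direction in \<open>ys\<close>, so compatibility is transferred to the
          reversed pair.\<close>
        ultimately have "seg_compat (v 0, z) f" using all unfolding noncrossing_def by metis
        then show "seg_compat (z, v 0) f" by (rule seg_compat_flip)
      qed
    qed
    then show ?thesis by blast
  qed
qed

end
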